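(* Let $m,n,r,s,\lambda$ be positive integers with $n>m\geq 4$, and suppose that if $m=4$ then $\lambda\geq 2$ and $r\geq 2$. Suppose that $n\geq 4m/3$ and $r\binom{n-1}{3}=s\binom{m-1}{3}$, and let an $r$-factorization of $\lambda K_m^4$ be given. Then this $r$-factorization of $\lambda K_m^4$ can be extended to an $s$-factorization of $\lambda K_n^4$ if and only if $4\mid rm$, $4\mid sn$, $r\mid \lambda\binom{m-1}{3}$, $s\mid\lambda\binom{n-1}{3}$, and $1\leq \dfrac{s}{r}\leq \binom{n-1}{3}\Big/\binom{m-1}{3}$.
   Context: For positive integers $m,h,\lambda$, $\lambda K_m^h$ denotes the collection of all $h$-subsets (called edges) of the vertex set $[m]=\{1,\dots,m\}$, where each $h$-subset occurs $\lambda$ times (the $\lambda$ copies are regarded as distinct edges). A $q$-coloring of $\lambda K_m^h$ is a map from its edges to $[q]$; the edges mapped to $j\in[q]$ form color class $j$. The degree of a vertex in a color class is the number of edges of that color class containing it. An $r$-factorization of $\lambda K_m^h$ is a coloring (with some number $q$ of colors) such that in every color class every vertex of $[m]$ has degree exactly $r$. For $n>m$, $\lambda K_m^h$ is regarded as the subcollection of $\lambda K_n^h$ consisting of all edges contained in $[m]$. An $r$-factorization of $\lambda K_m^h$ can be extended to an $s$-factorization of $\lambda K_n^h$ if there is an $s$-factorization of $\lambda K_n^h$, whose set of colors contains the set of colors of the $r$-factorization, in which every edge of $\lambda K_m^h$ has the same color as in the $r$-factorization. *)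

theory Defs
  imports Complex_Main "HOL-Library.FuncSet"
begin

text \<open>The pair \<open>(S, i)\<close> is the \<open>i\<close>-th copy of the \<open>h\<close>-subset \<open>S\<close> of \<open>{1..m}\<close>. With this
  encoding \<open>hyp_edges lam m h \<subseteq> hyp_edges lam n h\<close> holds literally for \<open>m \<le> n\<close>.\<close>

definition hyp_edges :: "nat \<Rightarrow> nat \<Rightarrow> nat \<Rightarrow> (nat set \<times> nat) set" where
  "hyp_edges lam m h = {S. S \<subseteq> {1..m} \<and> card S = h} \<times> {1..lam}"

text \<open>Only the values of a coloring on the edges matter; a coloring need not use every color.\<close>

definition is_coloring :: "nat \<Rightarrow> nat \<Rightarrow> nat \<Rightarrow> nat \<Rightarrow> (nat set \<times> nat \<Rightarrow> nat) \<Rightarrow> bool" where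
  "is_coloring lam m h q c \<longleftrightarrow> c \<in> hyp_edges lam m h \<rightarrow> {1..q}"

definition color_class ::
    "nat \<Rightarrow> nat \<Rightarrow> nat \<Rightarrow> (nat set \<times> nat \<Rightarrow> nat) \<Rightarrow> nat \<Rightarrow> (nat set \<times> nat) set" where
  "color_class lam m h c j = {e \<in> hyp_edges lam m h. c e = j}"

definition degree_in :: "(nat set \<times> nat) set \<Rightarrow> nat \<Rightarrow> nat" where
  "degree_in C v = card {e \<in> C. v \<in> fst e}"

definition is_factorization ::
    "nat \<Rightarrow> nat \<Rightarrow> nat \<Rightarrow> nat \<Rightarrow> nat \<Rightarrow> (nat set \<times> nat \<Rightarrow> nat) \<Rightarrow> bool" where
  "is_factorization r lam m h q c \<longleftrightarrow> is_coloring lam m h q c \<and>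
     (\<forall>j\<in>{1..q}. \<forall>v\<in>{1..m}. degree_in (color_class lam m h c j) v = r)"

text \<open>The coloring \<open>c\<close> of the edges on \<open>{1..m}\<close>, with color set \<open>{1..q}\<close>, extends to an
  \<open>s\<close>-factorization on \<open>{1..n}\<close>, which may use additional colors.\<close>

definition can_be_extended ::
    "nat \<Rightarrow> nat \<Rightarrow> nat \<Rightarrow> (nat set \<times> nat \<Rightarrow> nat) \<Rightarrow> nat \<Rightarrow> nat \<Rightarrow> nat \<Rightarrow> bool" where
  "can_be_extended lam m q c s n h \<longleftrightarrow>
     (\<exists>q' c'. is_factorization s lam n h q' c' \<and> {1..q} \<subseteq> {1..q'} \<and>
        (\<forall>e\<in>hyp_edges lam m h. c' e = c e))"

end

theory Submission
  imports Defs
begin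

text \<open>Counting the pairs of a vertex and an edge at it in one color class shows that \<open>4\<close> divides
  \<open>r m\<close> and \<open>s n\<close> if there are such factorizations, and counting over all classes shows that the
  number of colors is \<open>\<lambda> C(m-1,3) / r\<close> and \<open>\<lambda> C(n-1,3) / s\<close>. These numbers agree because of
  \<open>r C(n-1,3) = s C(m-1,3)\<close>. So an extension has exactly the given \<open>q\<close> colors, every color class has
  to grow from degree \<open>r\<close> to degree \<open>s\<close>, and once the factorization and the ratio \<open>s / r\<close> are given,
  everything hinges on \<open>4 dvd s n\<close>. The work is to construct an extension under this condition.

  The construction goes from coarse to fine. Call \<open>i\<close> the type of an edge with \<open>i\<close> vertices in
  \<open>{1..m}\<close>. First only the number \<open>e j i\<close> of edges of type \<open>i \<le> 3\<close> in color \<open>j\<close> is chosen. The total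
  over all colors is the number of edges of type \<open>i\<close>; and within color \<open>j\<close> the degrees of the old
  vertices must add up to \<open>m (s - r)\<close>, those of the new vertices to \<open>(n - m) s\<close>. Next it is decided
  which old vertices these edges contain, and finally which new ones. Both refinements are instances of
  \<open>regular_detachment\<close>, a form of Baranyai's theorem in which edges of several prescribed types are
  spread over a vertex set: they can be spread so that every set receives its multiplicity and every
  color class is regular, provided that the obvious counting conditions hold. It is proved by treating
  one vertex at a time. Spreading everything uniformly is a fractional solution; it has integral row
  and column sums, and \<open>matrix_rounding\<close> makes its entries integral without changing these sums.

  What remains is to find the numbers \<open>e j i\<close> (\<open>equitable_type_distribution\<close>). The four numbers of a
  color satisfy two linear equations, so \<open>e j 0\<close> and \<open>e j 0 + e j 1\<close> determine the others. These two
  are shared among the colors as evenly as possible. The resulting \<open>e j 2\<close> then differs from its average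
  by less than \<open>3\<close> and \<open>e j 3\<close> by less than \<open>2\<close>; being integers, both are nonnegative as soon as their
  averages are at least \<open>2\<close> and at least \<open>1\<close>. This is where \<open>n \<ge> 4 m / 3\<close> enters.\<close>

section \<open>Rounding a matrix with integral row and column sums\<close>

lemma homogeneous_system_nontrivial_solution:
  fixes a :: "'e \<Rightarrow> 'p \<Rightarrow> real"
  assumes "finite E" "finite P" "card E < card P"
  shows "\<exists>z. (\<forall>e\<in>E. (\<Sum>p\<in>P. a e p * z p) = 0) \<and> (\<exists>p\<in>P. z p \<noteq> 0)"
  using assms
proof (induction E arbitrary: P a rule: finite_induct)
  case empty
  then have "P \<noteq> {}" by auto
  then show ?case by (intro exI[of _ "\<lambda>_. 1"]) auto
next
  case (insert e E)
  show ?case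
  proof (cases "\<exists>p\<in>P. a e p \<noteq> 0")
    case False
    have "card E < card P" using insert by simp
    from insert.IH[OF insert.prems(1) this, of a] obtain z
      where "\<forall>e\<in>E. (\<Sum>p\<in>P. a e p * z p) = 0" "\<exists>p\<in>P. z p \<noteq> 0" by auto
    with False show ?thesis by (intro exI[of _ z]) auto
  next
    case True
    then obtain p where p: "p \<in> P" "a e p \<noteq> 0" by auto
    define Q where "Q = P - {p}"
    have Q: "finite Q" "p \<notin> Q" "P = insert p Q" "card E < card Q"
      using insert p by (auto simp: Q_def)
    \<comment> \<open>the equation \<open>e\<close> is solved for the unknown \<open>p\<close>, which is then eliminated from the others\<close>
    define b where "b = (\<lambda>e' x. a e' x - a e' p * a e x / a e p)"
    from insert.IH[OF Q(1,4), of b] obtain z where z: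
      "\<forall>e\<in>E. (\<Sum>x\<in>Q. b e x * z x) = 0" "\<exists>x\<in>Q. z x \<noteq> 0" by auto
    define z' where "z' = z(p := - (\<Sum>x\<in>Q. a e x * z x) / a e p)"
    have z'_Q: "(\<Sum>x\<in>Q. f x * z' x) = (\<Sum>x\<in>Q. f x * z x)" for f
      using Q(2) by (intro sum.cong) (auto simp: z'_def)
    have sum_P: "(\<Sum>x\<in>P. f x * z' x) =
        (\<Sum>x\<in>Q. f x * z x) - f p * (\<Sum>x\<in>Q. a e x * z x) / a e p" for f
      using Q by (simp add: z'_Q) (simp add: z'_def)
    have "(\<Sum>x\<in>P. a e' x * z' x) = 0" if "e' \<in> E" for e'
    proof -
      have "(\<Sum>x\<in>P. a e' x * z' x) = (\<Sum>x\<in>Q. b e' x * z x)"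
        unfolding sum_P b_def
        by (simp add: left_diff_distrib sum_subtractf sum_distrib_left sum_divide_distrib mult.assoc)
      with z that show ?thesis by simp
    qed
    moreover have "(\<Sum>x\<in>P. a e x * z' x) = 0"
      using p by (simp add: sum_P)
    moreover have "\<exists>x\<in>P. z' x \<noteq> 0"
      using z(2) Q by (auto simp: z'_def)
    ultimately show ?thesis by blast
  qed
qed

lemma integer_sum_another_fraction:
  fixes w :: "'p \<Rightarrow> real"
  assumes "finite A" "(\<Sum>x\<in>A. w x) \<in> \<int>" "p \<in> A" "w p \<notin> \<int>"
  shows "\<exists>p'\<in>A. p' \<noteq> p \<and> w p' \<notin> \<int>"
proof (rule ccontr)
  assume "\<not> ?thesis"
  then have "(\<Sum>x\<in>A - {p}. w x) \<in> \<int>" by (intro Ints_sum) auto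
  moreover have "w p = (\<Sum>x\<in>A. w x) - (\<Sum>x\<in>A - {p}. w x)"
    using assms by (simp add: sum.remove)
  ultimately have "w p \<in> \<int>" using assms(2) by simp
  with assms show False by simp
qed

lemma twice_card_image_le:
  assumes "finite F" "\<And>x. x \<in> F \<Longrightarrow> \<exists>x'\<in>F. x' \<noteq> x \<and> f x' = f x"
  shows "2 * card (f ` F) \<le> card F"
proof -
  have "card F = (\<Sum>y\<in>f ` F. card {x \<in> F. f x = y})"
    using sum.image_gen[OF assms(1), of "\<lambda>_. 1 :: nat" f] by simp
  also have "\<dots> \<ge> (\<Sum>y\<in>f ` F. 2)"
  proof (rule sum_mono)
    fix y assume "y \<in> f ` F"
    then obtain x x' where "x \<in> F" "x' \<in> F" "x' \<noteq> x" "f x = y" "f x' = y"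
      using assms(2) by blast
    then have "card {x, x'} \<le> card {x \<in> F. f x = y}"
      using assms(1) by (intro card_mono) auto
    then show "2 \<le> card {x \<in> F. f x = y}" using \<open>x' \<noteq> x\<close> by simp
  qed
  finally show ?thesis by simp
qed

text \<open>A row or column with integral sum cannot contain exactly one fractional entry. Hence there are at
  least twice as many fractional entries as rows meeting them, and the same for columns, so at least as
  many as rows and columns together. Among the equations saying that the lines sum to zero, one follows from the
  others, since the row sums and the column sums have the same total; so the homogeneous system on the
  fractional positions has fewer equations than unknowns.\<close>

lemma balanced_perturbation:
  fixes w :: "'a \<times> 'b \<Rightarrow> real"
  assumes "finite A" "finite B"
    and rows: "\<And>a. a \<in> A \<Longrightarrow> (\<Sum>b\<in>B. w (a, b)) \<in> \<int>"
    and cols: "\<And>b. b \<in> B \<Longrightarrow> (\<Sum>a\<in>A. w (a, b)) \<in> \<int>"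
    and "\<exists>p\<in>A \<times> B. w p \<notin> \<int>"
  shows "\<exists>z :: 'a \<times> 'b \<Rightarrow> real.
    (\<forall>a\<in>A. (\<Sum>b\<in>B. z (a, b)) = 0) \<and> (\<forall>b\<in>B. (\<Sum>a\<in>A. z (a, b)) = 0) \<and>
    (\<forall>p\<in>A \<times> B. w p \<in> \<int> \<longrightarrow> z p = 0) \<and> (\<exists>p\<in>A \<times> B. z p \<noteq> 0)"
proof -
  define F where "F = {p \<in> A \<times> B. w p \<notin> \<int>}"
  have F: "finite F" "F \<noteq> {}" using assms by (auto simp: F_def)
  have "2 * card (fst ` F) \<le> card F"
  proof (rule twice_card_image_le[OF F(1)])
    fix p assume p: "p \<in> F"
    obtain a b where ab: "p = (a, b)" by fastforce
    with p have "\<exists>b'\<in>B. b' \<noteq> b \<and> w (a, b') \<notin> \<int>"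
      using integer_sum_another_fraction[of B "\<lambda>b. w (a, b)" b] rows assms(2) by (auto simp: F_def)
    with p ab show "\<exists>x'\<in>F. x' \<noteq> p \<and> fst x' = fst p" by (fastforce simp: F_def)
  qed
  moreover have "2 * card (snd ` F) \<le> card F"
  proof (rule twice_card_image_le[OF F(1)])
    fix p assume p: "p \<in> F"
    obtain a b where ab: "p = (a, b)" by fastforce
    with p have "\<exists>a'\<in>A. a' \<noteq> a \<and> w (a', b) \<notin> \<int>"
      using integer_sum_another_fraction[of A "\<lambda>a. w (a, b)" a] cols assms(1) by (auto simp: F_def)
    with p ab show "\<exists>x'\<in>F. x' \<noteq> p \<and> snd x' = snd p" by (fastforce simp: F_def)
  qed
  ultimately have cardF: "card (fst ` F) + card (snd ` F) \<le> card F" by simp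
  obtain b0 where b0: "b0 \<in> snd ` F" using F by auto
  \<comment> \<open>the equation of column \<open>b0\<close> is left out and recovered at the end from the other ones\<close>
  define E where "E = fst ` F <+> (snd ` F - {b0})"
  have fE: "finite E" using F by (auto simp: E_def)
  have "card E = card (fst ` F) + (card (snd ` F) - 1)"
    using F b0 by (simp add: E_def card_Plus)
  moreover have "card (snd ` F) > 0" using b0 F(1) by (auto simp: card_gt_0_iff)
  ultimately have "card E < card F" using cardF by linarith
  define M :: "'a + 'b \<Rightarrow> 'a \<times> 'b \<Rightarrow> real" where
    "M e p = (case e of Inl a \<Rightarrow> of_bool (fst p = a) | Inr b \<Rightarrow> of_bool (snd p = b))" for e p
  from homogeneous_system_nontrivial_solution[OF fE F(1) \<open>card E < card F\<close>, of M]
  obtain z0 where sol: "\<forall>e\<in>E. (\<Sum>p\<in>F. M e p * z0 p) = 0" and nz: "\<exists>p\<in>F. z0 p \<noteq> 0"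
    by blast
  have z0: "\<And>a. a \<in> fst ` F \<Longrightarrow> (\<Sum>p\<in>F. of_bool (fst p = a) * z0 p) = 0"
      "\<And>b. b \<in> snd ` F - {b0} \<Longrightarrow> (\<Sum>p\<in>F. of_bool (snd p = b) * z0 p) = 0"
    using sol by (auto simp: M_def E_def Plus_def ball_Un)
  define z where "z = (\<lambda>p. if p \<in> F then z0 p else 0)"
  have row: "(\<Sum>b\<in>B. z (a, b)) = (\<Sum>p\<in>F. of_bool (fst p = a) * z0 p)" if "a \<in> A" for a
  proof -
    have "(\<Sum>b\<in>B. z (a, b)) = (\<Sum>p\<in>Pair a ` B. z p)" by (subst sum.reindex) (auto simp: inj_on_def)
    also have "\<dots> = (\<Sum>p\<in>A \<times> B. of_bool (fst p = a) * z p)"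
      using assms that by (intro sum.mono_neutral_cong_left) auto
    also have "\<dots> = (\<Sum>p\<in>F. of_bool (fst p = a) * z0 p)"
      using assms by (intro sum.mono_neutral_cong_right) (auto simp: z_def F_def)
    finally show ?thesis .
  qed
  have col: "(\<Sum>a\<in>A. z (a, b)) = (\<Sum>p\<in>F. of_bool (snd p = b) * z0 p)" if "b \<in> B" for b
  proof -
    have "(\<Sum>a\<in>A. z (a, b)) = (\<Sum>p\<in>(\<lambda>a. (a, b)) ` A. z p)" by (subst sum.reindex) (auto simp: inj_on_def)
    also have "\<dots> = (\<Sum>p\<in>A \<times> B. of_bool (snd p = b) * z p)"
      using assms that by (intro sum.mono_neutral_cong_left) auto
    also have "\<dots> = (\<Sum>p\<in>F. of_bool (snd p = b) * z0 p)"
      using assms by (intro sum.mono_neutral_cong_right) (auto simp: z_def F_def)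
    finally show ?thesis .
  qed
  have rows0: "(\<Sum>b\<in>B. z (a, b)) = 0" if "a \<in> A" for a
  proof (cases "a \<in> fst ` F")
    case True then show ?thesis using row[OF that] z0(1) by simp
  next
    case False
    then have "\<And>b. z (a, b) = 0" by (force simp: z_def)
    then show ?thesis by simp
  qed
  have cols0': "(\<Sum>a\<in>A. z (a, b)) = 0" if "b \<in> B" "b \<noteq> b0" for b
  proof (cases "b \<in> snd ` F")
    case True then show ?thesis using col[OF that(1)] z0(2) that by simp
  next
    case False
    then have "\<And>a. z (a, b) = 0" by (force simp: z_def)
    then show ?thesis by simp
  qed
  have b0B: "b0 \<in> B" using b0 by (auto simp: F_def)
  have "(\<Sum>b\<in>B. \<Sum>a\<in>A. z (a, b)) = (\<Sum>a\<in>A. \<Sum>b\<in>B. z (a, b))" by (rule sum.swap)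
  also have "\<dots> = 0" using rows0 by simp
  finally have "(\<Sum>a\<in>A. z (a, b0)) = 0"
    using cols0' b0B assms(2) by (simp add: sum.remove)
  with cols0' have cols0: "(\<Sum>a\<in>A. z (a, b)) = 0" if "b \<in> B" for b using that by blast
  have "\<forall>p\<in>A \<times> B. w p \<in> \<int> \<longrightarrow> z p = 0" "\<exists>p\<in>A \<times> B. z p \<noteq> 0"
    using nz by (auto simp: z_def F_def)
  with rows0 cols0 show ?thesis by (intro exI[of _ z]) blast
qed

text \<open>Walking from \<open>w\<close> in the direction \<open>z\<close>, the first moment at which some moving entry reaches the next
  integer: by then no entry has left the unit interval between its floor and its ceiling.\<close>

lemma step_to_integer:
  fixes w z :: "'p \<Rightarrow> real"
  assumes "finite P" "\<And>p. p \<in> P \<Longrightarrow> w p \<in> \<int> \<Longrightarrow> z p = 0" "\<exists>p\<in>P. z p \<noteq> 0"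
  shows "\<exists>t. (\<forall>p\<in>P. of_int \<lfloor>w p\<rfloor> \<le> w p + t * z p \<and> w p + t * z p \<le> of_int \<lceil>w p\<rceil>) \<and>
    (\<exists>p\<in>P. w p \<notin> \<int> \<and> w p + t * z p \<in> \<int>)"
proof -
  define Q where "Q = {p \<in> P. z p \<noteq> 0}"
  define g where "g p = (if z p > 0 then real_of_int \<lceil>w p\<rceil> else of_int \<lfloor>w p\<rfloor>)" for p
  \<comment> \<open>\<open>g p\<close> is the integer that entry \<open>p\<close> moves towards, and \<open>T p\<close> the time of its arrival\<close>
  define T where "T p = (g p - w p) / z p" for p
  have Q: "finite Q" "Q \<noteq> {}" using assms by (auto simp: Q_def)
  define t where "t = Min (T ` Q)"
  have tle: "t \<le> T p" if "p \<in> Q" for p using Q that by (simp add: t_def)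
  have "t \<in> T ` Q" unfolding t_def using Q by (intro Min_in) auto
  then obtain p0 where p0: "p0 \<in> Q" "t = T p0" by auto
  have "T p \<ge> 0" for p
    by (cases "z p > 0") (auto simp: T_def g_def divide_nonneg_pos divide_nonpos_neg divide_nonpos_nonpos)
  with p0 have t0: "t \<ge> 0" by simp
  have lo: "of_int \<lfloor>w p\<rfloor> \<le> w p + t * z p" and hi: "w p + t * z p \<le> of_int \<lceil>w p\<rceil>" if "p \<in> P" for p
  proof -
    consider "z p = 0" | "z p > 0" | "z p < 0" by linarith
    then have "of_int \<lfloor>w p\<rfloor> \<le> w p + t * z p \<and> w p + t * z p \<le> of_int \<lceil>w p\<rceil>"
    proof cases
      case 1 then show ?thesis by simp
    next
      case 2
      with that tle have "t \<le> T p" by (simp add: Q_def)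
      with 2 have "t * z p \<le> of_int \<lceil>w p\<rceil> - w p" by (simp add: T_def g_def pos_le_divide_eq)
      moreover have "t * z p \<ge> 0" using t0 2 by simp
      ultimately show ?thesis using of_int_floor_le[of "w p"] by linarith
    next
      case 3
      with that tle have "t \<le> T p" by (simp add: Q_def)
      with 3 have "t * z p \<ge> of_int \<lfloor>w p\<rfloor> - w p" by (simp add: T_def g_def neg_le_divide_eq)
      moreover have "t * z p \<le> 0" using t0 3 by (simp add: mult_nonneg_nonpos)
      ultimately show ?thesis using le_of_int_ceiling[of "w p"] by linarith
    qed
    then show "of_int \<lfloor>w p\<rfloor> \<le> w p + t * z p" "w p + t * z p \<le> of_int \<lceil>w p\<rceil>" by auto
  qed
  have "w p0 + t * z p0 = g p0" using p0 by (simp add: T_def Q_def)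
  then have "w p0 + t * z p0 \<in> \<int>" by (simp add: g_def)
  with p0 assms(2) have "\<exists>p\<in>P. w p \<notin> \<int> \<and> w p + t * z p \<in> \<int>" by (auto simp: Q_def)
  with lo hi show ?thesis by (intro exI[of _ t]) blast
qed

text \<open>As long as some entry is fractional, a balanced perturbation makes at least one more entry integral,
  so the number of fractional entries decreases.\<close>

lemma matrix_rounding:
  fixes w :: "'a \<times> 'b \<Rightarrow> real"
  assumes fin: "finite A" "finite B"
    and "\<And>a. a \<in> A \<Longrightarrow> (\<Sum>b\<in>B. w (a, b)) \<in> \<int>"
    and "\<And>b. b \<in> B \<Longrightarrow> (\<Sum>a\<in>A. w (a, b)) \<in> \<int>"
  shows "\<exists>x :: 'a \<times> 'b \<Rightarrow> int.
    (\<forall>a\<in>A. of_int (\<Sum>b\<in>B. x (a, b)) = (\<Sum>b\<in>B. w (a, b))) \<and>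
    (\<forall>b\<in>B. of_int (\<Sum>a\<in>A. x (a, b)) = (\<Sum>a\<in>A. w (a, b))) \<and>
    (\<forall>p\<in>A \<times> B. \<lfloor>w p\<rfloor> \<le> x p \<and> x p \<le> \<lceil>w p\<rceil>)"
  using assms(3,4)
proof (induction "card {p \<in> A \<times> B. w p \<notin> \<int>}" arbitrary: w rule: less_induct)
  case less
  show ?case
  proof (cases "\<exists>p\<in>A \<times> B. w p \<notin> \<int>")
    case False
    then have integral: "of_int \<lfloor>w (a, b)\<rfloor> = w (a, b)" if "a \<in> A" "b \<in> B" for a b using that by auto
    have "(\<Sum>b\<in>B. real_of_int \<lfloor>w (a, b)\<rfloor>) = (\<Sum>b\<in>B. w (a, b))" if "a \<in> A" for a
      using integral that by (intro sum.cong refl) blast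
    moreover have "(\<Sum>a\<in>A. real_of_int \<lfloor>w (a, b)\<rfloor>) = (\<Sum>a\<in>A. w (a, b))" if "b \<in> B" for b
      using integral that by (intro sum.cong refl) blast
    ultimately have sums: "\<forall>a\<in>A. of_int (\<Sum>b\<in>B. \<lfloor>w (a, b)\<rfloor>) = (\<Sum>b\<in>B. w (a, b))"
      "\<forall>b\<in>B. of_int (\<Sum>a\<in>A. \<lfloor>w (a, b)\<rfloor>) = (\<Sum>a\<in>A. w (a, b))"
      by simp_all
    show ?thesis
      by (rule exI[of _ "\<lambda>p. \<lfloor>w p\<rfloor>"]) (intro conjI sums ballI order_refl floor_le_ceiling)
  next
    case True
    have "\<exists>z :: 'a \<times> 'b \<Rightarrow> real.
        (\<forall>a\<in>A. (\<Sum>b\<in>B. z (a, b)) = 0) \<and> (\<forall>b\<in>B. (\<Sum>a\<in>A. z (a, b)) = 0) \<and>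
        (\<forall>p\<in>A \<times> B. w p \<in> \<int> \<longrightarrow> z p = 0) \<and> (\<exists>p\<in>A \<times> B. z p \<noteq> 0)"
      by (rule balanced_perturbation) (fact fin less.prems True)+
    then obtain z :: "'a \<times> 'b \<Rightarrow> real" where z:
      "\<forall>a\<in>A. (\<Sum>b\<in>B. z (a, b)) = 0" "\<forall>b\<in>B. (\<Sum>a\<in>A. z (a, b)) = 0"
      "\<forall>p\<in>A \<times> B. w p \<in> \<int> \<longrightarrow> z p = 0" "\<exists>p\<in>A \<times> B. z p \<noteq> 0"
      by (elim exE conjE)
    have "\<exists>t. (\<forall>p\<in>A \<times> B. of_int \<lfloor>w p\<rfloor> \<le> w p + t * z p \<and> w p + t * z p \<le> of_int \<lceil>w p\<rceil>) \<and>
        (\<exists>p\<in>A \<times> B. w p \<notin> \<int> \<and> w p + t * z p \<in> \<int>)"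
      using fin z(3,4) by (intro step_to_integer) blast+
    then obtain t where
      t: "\<forall>p\<in>A \<times> B. of_int \<lfloor>w p\<rfloor> \<le> w p + t * z p \<and> w p + t * z p \<le> of_int \<lceil>w p\<rceil>"
        "\<exists>p\<in>A \<times> B. w p \<notin> \<int> \<and> w p + t * z p \<in> \<int>"
      by (elim exE conjE)
    define w' where "w' p = w p + t * z p" for p
    have rows: "(\<Sum>b\<in>B. w' (a, b)) = (\<Sum>b\<in>B. w (a, b))" if "a \<in> A" for a
      using bspec[OF z(1) that] by (simp add: w'_def sum.distrib flip: sum_distrib_left)
    have cols: "(\<Sum>a\<in>A. w' (a, b)) = (\<Sum>a\<in>A. w (a, b))" if "b \<in> B" for b
      using bspec[OF z(2) that] by (simp add: w'_def sum.distrib flip: sum_distrib_left)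
    have "{p \<in> A \<times> B. w' p \<notin> \<int>} \<subset> {p \<in> A \<times> B. w p \<notin> \<int>}"
      using z(3) t(2) by (auto simp: w'_def)
    then have "card {p \<in> A \<times> B. w' p \<notin> \<int>} < card {p \<in> A \<times> B. w p \<notin> \<int>}"
      using fin by (intro psubset_card_mono) auto
    from less.hyps[OF this] obtain x where x:
      "\<forall>a\<in>A. of_int (\<Sum>b\<in>B. x (a, b)) = (\<Sum>b\<in>B. w' (a, b))"
      "\<forall>b\<in>B. of_int (\<Sum>a\<in>A. x (a, b)) = (\<Sum>a\<in>A. w' (a, b))"
      "\<forall>p\<in>A \<times> B. \<lfloor>w' p\<rfloor> \<le> x p \<and> x p \<le> \<lceil>w' p\<rceil>"
      using less.prems rows cols by auto
    have "\<lfloor>w p\<rfloor> \<le> x p \<and> x p \<le> \<lceil>w p\<rceil>" if "p \<in> A \<times> B" for p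
    proof -
      have "\<lfloor>w p\<rfloor> \<le> \<lfloor>w' p\<rfloor>" using bspec[OF t(1) that] by (simp add: w'_def le_floor_iff)
      moreover have "\<lceil>w' p\<rceil> \<le> \<lceil>w p\<rceil>" using bspec[OF t(1) that] by (simp add: w'_def ceiling_le_iff)
      ultimately show ?thesis using x(3) that by (meson order_trans)
    qed
    with x rows cols show ?thesis by auto
  qed
qed

text \<open>The form used below: the entries are \<open>w a b / D\<close>. The last conclusion says that \<open>x a b\<close> does not exceed
  the rounded-up entry; as \<open>y\<close> may be \<open>0\<close>, zero entries stay zero.\<close>

lemma nat_matrix_rounding:
  fixes w :: "'a \<Rightarrow> 'b \<Rightarrow> nat"
  assumes fin: "finite A" "finite B" and D: "D > 0"
    and rows: "\<And>a. a \<in> A \<Longrightarrow> (\<Sum>b\<in>B. w a b) = D * R a"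
    and cols: "\<And>b. b \<in> B \<Longrightarrow> (\<Sum>a\<in>A. w a b) = D * C b"
  shows "\<exists>x :: 'a \<Rightarrow> 'b \<Rightarrow> nat.
    (\<forall>a\<in>A. (\<Sum>b\<in>B. x a b) = R a) \<and> (\<forall>b\<in>B. (\<Sum>a\<in>A. x a b) = C b) \<and>
    (\<forall>a\<in>A. \<forall>b\<in>B. \<forall>y. w a b \<le> D * y \<longrightarrow> x a b \<le> y)"
proof -
  define v where "v = (\<lambda>(a, b). real (w a b) / real D)"
  have rowv: "(\<Sum>b\<in>B. v (a, b)) = real (R a)" if "a \<in> A" for a
    using rows[OF that] D by (simp add: v_def flip: sum_divide_distrib of_nat_sum)
  have colv: "(\<Sum>a\<in>A. v (a, b)) = real (C b)" if "b \<in> B" for b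
    using cols[OF that] D by (simp add: v_def flip: sum_divide_distrib of_nat_sum)
  have "\<exists>x :: 'a \<times> 'b \<Rightarrow> int.
    (\<forall>a\<in>A. of_int (\<Sum>b\<in>B. x (a, b)) = (\<Sum>b\<in>B. v (a, b))) \<and>
    (\<forall>b\<in>B. of_int (\<Sum>a\<in>A. x (a, b)) = (\<Sum>a\<in>A. v (a, b))) \<and>
    (\<forall>p\<in>A \<times> B. \<lfloor>v p\<rfloor> \<le> x p \<and> x p \<le> \<lceil>v p\<rceil>)"
    by (rule matrix_rounding[OF fin]) (simp_all add: rowv colv)
  then obtain x :: "'a \<times> 'b \<Rightarrow> int" where
    sums: "\<forall>a\<in>A. of_int (\<Sum>b\<in>B. x (a, b)) = (\<Sum>b\<in>B. v (a, b))"
      "\<forall>b\<in>B. of_int (\<Sum>a\<in>A. x (a, b)) = (\<Sum>a\<in>A. v (a, b))"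
    and bounds: "\<forall>p\<in>A \<times> B. \<lfloor>v p\<rfloor> \<le> x p \<and> x p \<le> \<lceil>v p\<rceil>"
    by (elim exE conjE)
  have x1: "(\<Sum>b\<in>B. x (a, b)) = int (R a)" if "a \<in> A" for a
    using bspec[OF sums(1) that] rowv[OF that] by linarith
  have x2: "(\<Sum>a\<in>A. x (a, b)) = int (C b)" if "b \<in> B" for b
    using bspec[OF sums(2) that] colv[OF that] by linarith
  have nonneg: "0 \<le> x (a, b)" if "a \<in> A" "b \<in> B" for a b
  proof -
    have "0 \<le> \<lfloor>v (a, b)\<rfloor>" by (simp add: v_def)
    also have "\<dots> \<le> x (a, b)" using bounds that by blast
    finally show ?thesis .
  qed
  have upper: "x (a, b) \<le> int y" if "a \<in> A" "b \<in> B" "w a b \<le> D * y" for a b y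
  proof -
    have "real (w a b) \<le> real D * real y" using that(3) by (metis of_nat_le_iff of_nat_mult)
    then have "v (a, b) \<le> real y" using D by (simp add: v_def divide_le_eq mult.commute)
    then have "\<lceil>v (a, b)\<rceil> \<le> int y" by (simp add: ceiling_le_iff)
    moreover have "x (a, b) \<le> \<lceil>v (a, b)\<rceil>" using bounds that by blast
    ultimately show ?thesis by linarith
  qed
  show ?thesis
  proof (intro exI[of _ "\<lambda>a b. nat (x (a, b))"] conjI ballI allI impI)
    fix a assume a: "a \<in> A"
    have "int (\<Sum>b\<in>B. nat (x (a, b))) = (\<Sum>b\<in>B. x (a, b))"
      using nonneg a by (simp)
    also have "\<dots> = int (R a)" using x1[OF a] .
    finally show "(\<Sum>b\<in>B. nat (x (a, b))) = R a" by linarith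
  next
    fix b assume b: "b \<in> B"
    have "int (\<Sum>a\<in>A. nat (x (a, b))) = (\<Sum>a\<in>A. x (a, b))"
      using nonneg b by (simp)
    also have "\<dots> = int (C b)" using x2[OF b] .
    finally show "(\<Sum>a\<in>A. nat (x (a, b))) = C b" by linarith
  next
    fix a b y assume "a \<in> A" "b \<in> B" "w a b \<le> D * y"
    from upper[OF this] show "nat (x (a, b)) \<le> y" by linarith
  qed
qed

section \<open>Spreading edges of several types over a vertex set\<close>

definition small_subsets :: "'b set \<Rightarrow> nat \<Rightarrow> 'b set set" where
  "small_subsets U k = {S. S \<subseteq> U \<and> card S \<le> k}"

lemma finite_small_subsets: "finite U \<Longrightarrow> finite (small_subsets U k)"
  unfolding small_subsets_def by (rule finite_subset[of _ "Pow U"]) auto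

lemma sum_small_subsets_insert:
  fixes g :: "'b set \<Rightarrow> nat"
  assumes "finite U" "v \<notin> U"
  shows "(\<Sum>S\<in>small_subsets (insert v U) k. g S) =
    (\<Sum>S\<in>small_subsets U k. g S) + (\<Sum>S\<in>small_subsets U k. of_bool (card S < k) * g (insert v S))"
proof -
  let ?B = "{S \<in> small_subsets U k. card S < k}"
  have "small_subsets (insert v U) k = small_subsets U k \<union> insert v ` ?B"
  proof (intro equalityI subsetI)
    fix S assume S: "S \<in> small_subsets (insert v U) k"
    show "S \<in> small_subsets U k \<union> insert v ` ?B"
    proof (cases "v \<in> S")
      case True
      have "finite S" using S assms(1) by (auto simp: small_subsets_def intro: finite_subset)
      then have "card (S - {v}) < card S" using True by (rule card_Diff1_less)
      with S True have "S - {v} \<in> ?B" "S = insert v (S - {v})" by (auto simp: small_subsets_def)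
      then show ?thesis by blast
    qed (use S in \<open>auto simp: small_subsets_def\<close>)
  next
    fix S assume "S \<in> small_subsets U k \<union> insert v ` ?B"
    then show "S \<in> small_subsets (insert v U) k"
    proof
      assume "S \<in> insert v ` ?B"
      then obtain S0 where S0: "S0 \<subseteq> U" "card S0 < k" "S = insert v S0"
        by (auto simp: small_subsets_def)
      then have "v \<notin> S0" "finite S0" using assms by (auto intro: finite_subset)
      with S0 show ?thesis by (simp add: small_subsets_def subset_insertI2)
    qed (auto simp: small_subsets_def)
  qed
  moreover have "small_subsets U k \<inter> insert v ` ?B = {}"
    using assms by (auto simp: small_subsets_def)
  ultimately have "(\<Sum>S\<in>small_subsets (insert v U) k. g S) =
      (\<Sum>S\<in>small_subsets U k. g S) + (\<Sum>S\<in>insert v ` ?B. g S)"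
    using assms by (simp add: sum.union_disjoint finite_small_subsets)
  also have "inj_on (insert v) ?B"
    using assms by (intro inj_onI) (auto simp: small_subsets_def)
  then have "(\<Sum>S\<in>insert v ` ?B. g S) = (\<Sum>S\<in>?B. g (insert v S))"
    by (simp add: sum.reindex)
  also have "\<dots> = (\<Sum>S\<in>small_subsets U k. of_bool (card S < k) * g (insert v S))"
    using assms by (intro sum.mono_neutral_cong_left) (auto simp: finite_small_subsets)
  finally show ?thesis .
qed

lemma sum_card_double_count:
  fixes f :: "'b set \<Rightarrow> nat"
  assumes "finite U" "\<And>S. S \<in> A \<Longrightarrow> S \<subseteq> U"
  shows "(\<Sum>S\<in>A. card S * f S) = (\<Sum>u\<in>U. \<Sum>S\<in>A. of_bool (u \<in> S) * f S)"
proof -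
  have "card S = (\<Sum>u\<in>U. of_bool (u \<in> S))" if "S \<in> A" for S
  proof -
    have "(\<Sum>u\<in>U. of_bool (u \<in> S)) = (\<Sum>u\<in>S. 1 :: nat)"
      using assms that by (intro sum.mono_neutral_cong_right) auto
    then show ?thesis by simp
  qed
  then have "(\<Sum>S\<in>A. card S * f S) = (\<Sum>S\<in>A. \<Sum>u\<in>U. of_bool (u \<in> S) * f S)"
    by (simp add: sum_distrib_right)
  also have "\<dots> = (\<Sum>u\<in>U. \<Sum>S\<in>A. of_bool (u \<in> S) * f S)" by (rule sum.swap)
  finally show ?thesis .
qed

text \<open>The state of the construction when the vertices in \<open>U\<close>, out of \<open>N\<close>, have been treated. An edge of type
  \<open>t\<close> is going to have \<open>h t\<close> vertices, and \<open>y j t S\<close> counts those of color \<open>j\<close> whose part inside \<open>U\<close> is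
  \<open>S\<close>. The first condition is that all colors together contain the right number of them: every
  set of size \<open>h t\<close> is to occur \<open>\<mu> t\<close> times, and \<open>S\<close> can be completed to such a set by choosing
  \<open>h t - card S\<close> of the \<open>N - card U\<close> vertices to come.\<close>

definition partial_detachment ::
  "'j set \<Rightarrow> 't set \<Rightarrow> ('t \<Rightarrow> nat) \<Rightarrow> ('t \<Rightarrow> nat) \<Rightarrow> ('j \<Rightarrow> 't \<Rightarrow> nat) \<Rightarrow> ('j \<Rightarrow> nat) \<Rightarrow> nat \<Rightarrow> 'b set
    \<Rightarrow> ('j \<Rightarrow> 't \<Rightarrow> 'b set \<Rightarrow> nat) \<Rightarrow> bool" where
  "partial_detachment J T h \<mu> e d N U y \<longleftrightarrow>
    (\<forall>t\<in>T. \<forall>S\<in>small_subsets U (h t).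
      (\<Sum>j\<in>J. y j t S) = \<mu> t * ((N - card U) choose (h t - card S))) \<and>
    (\<forall>j\<in>J. \<forall>t\<in>T. (\<Sum>S\<in>small_subsets U (h t). y j t S) = e j t) \<and>
    (\<forall>j\<in>J. \<forall>u\<in>U. (\<Sum>t\<in>T. \<Sum>S\<in>small_subsets U (h t). of_bool (u \<in> S) * y j t S) = d j)"

text \<open>Among the \<open>D = N - card U\<close> vertices to come, the edges counted by \<open>y j t S\<close> still have \<open>h t - card S\<close>
  places to fill, so on average \<open>(h t - card S) / D\<close> of them should contain the next vertex \<open>v\<close>. The matrix
  of these fractions, with colors as rows and pairs \<open>(t, S)\<close> as columns, has row sums \<open>d j\<close> by the degree
  conditions, and integral column sums by the absorption identity for binomial coefficients. After
  rounding, \<open>x j (t, S)\<close> is the number of edges that receive \<open>v\<close>.\<close>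

lemma partial_detachment_step:
  fixes y :: "'j \<Rightarrow> 't \<Rightarrow> 'b set \<Rightarrow> nat"
  assumes fin: "finite J" "finite T" "finite U" and v: "v \<notin> U" and N: "card U < N"
    and deg: "\<And>j. j \<in> J \<Longrightarrow> (\<Sum>t\<in>T. h t * e j t) = N * d j"
    and y: "partial_detachment J T h \<mu> e d N U y"
  shows "\<exists>y'. partial_detachment J T h \<mu> e d N (insert v U) y'"
proof -
  define D where "D = N - card U"
  have D: "D > 0" using N by (simp add: D_def)
  define K where "K = (SIGMA t:T. small_subsets U (h t))"
  have finS: "finite (small_subsets U k)" for k using fin by (simp add: finite_small_subsets)
  have finK: "finite K" using fin finS by (auto simp: K_def)
  have y1: "(\<Sum>j\<in>J. y j t S) = \<mu> t * (D choose (h t - card S))"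
    if "t \<in> T" "S \<in> small_subsets U (h t)" for t S
    using y that by (auto simp: partial_detachment_def D_def)
  have y2: "(\<Sum>S\<in>small_subsets U (h t). y j t S) = e j t" if "j \<in> J" "t \<in> T" for j t
    using y that by (auto simp: partial_detachment_def)
  have y3: "(\<Sum>t\<in>T. \<Sum>S\<in>small_subsets U (h t). of_bool (u \<in> S) * y j t S) = d j"
    if "j \<in> J" "u \<in> U" for j u
    using y that by (auto simp: partial_detachment_def)
  define w where "w = (\<lambda>j (t, S). (h t - card S) * y j t S)"
  define C where "C = (\<lambda>(t, S :: 'b set). if card S < h t
    then \<mu> t * ((D - 1) choose (h t - card S - 1)) else 0)"
  have rows: "(\<Sum>p\<in>K. w j p) = D * d j" if j: "j \<in> J" for j
  proof -
    have "(\<Sum>t\<in>T. \<Sum>S\<in>small_subsets U (h t). card S * y j t S) =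
        (\<Sum>t\<in>T. \<Sum>u\<in>U. \<Sum>S\<in>small_subsets U (h t). of_bool (u \<in> S) * y j t S)"
      using fin by (intro sum.cong refl sum_card_double_count) (auto simp: small_subsets_def)
    also have "\<dots> = (\<Sum>u\<in>U. \<Sum>t\<in>T. \<Sum>S\<in>small_subsets U (h t). of_bool (u \<in> S) * y j t S)"
      by (rule sum.swap)
    also have "\<dots> = card U * d j" using y3[OF j] by simp
    finally have used: "(\<Sum>t\<in>T. \<Sum>S\<in>small_subsets U (h t). card S * y j t S) = card U * d j" .
    have "(\<Sum>p\<in>K. w j p) + card U * d j =
        (\<Sum>t\<in>T. \<Sum>S\<in>small_subsets U (h t). (h t - card S) * y j t S + card S * y j t S)"
      unfolding used[symmetric] K_def w_def using fin finS
      by (simp add: sum.Sigma sum.distrib)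
    also have "\<dots> = (\<Sum>t\<in>T. \<Sum>S\<in>small_subsets U (h t). h t * y j t S)"
      by (intro sum.cong refl) (auto simp: small_subsets_def simp flip: add_mult_distrib)
    also have "\<dots> = N * d j"
      using y2[OF j] deg[OF j] by (simp flip: sum_distrib_left)
    finally show ?thesis using N by (simp add: D_def diff_mult_distrib)
  qed
  have cols: "(\<Sum>j\<in>J. w j p) = D * C p" if p: "p \<in> K" for p
  proof -
    obtain t S where tS: "p = (t, S)" "t \<in> T" "S \<in> small_subsets U (h t)"
      using p by (auto simp: K_def)
    have sw: "(\<Sum>j\<in>J. w j p) = (h t - card S) * (\<mu> t * (D choose (h t - card S)))"
      using tS y1 by (simp add: w_def flip: sum_distrib_left)
    show ?thesis
    proof (cases "card S < h t")
      case True
      then have "(h t - card S) * (D choose (h t - card S)) = D * ((D - 1) choose (h t - card S - 1))"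
        using D by (metis Suc_diff_1 Suc_times_binomial_eq mult.commute zero_less_diff)
      with True show ?thesis unfolding sw by (simp add: tS C_def)
    next
      case False
      then show ?thesis unfolding sw by (simp add: tS C_def)
    qed
  qed
  have "\<exists>x. (\<forall>j\<in>J. (\<Sum>p\<in>K. x j p) = d j) \<and> (\<forall>p\<in>K. (\<Sum>j\<in>J. x j p) = C p) \<and>
      (\<forall>j\<in>J. \<forall>p\<in>K. \<forall>b. w j p \<le> D * b \<longrightarrow> x j p \<le> b)"
    by (rule nat_matrix_rounding) (fact fin finK D rows cols)+
  then obtain x where x: "\<And>j. j \<in> J \<Longrightarrow> (\<Sum>p\<in>K. x j p) = d j"
    "\<And>p. p \<in> K \<Longrightarrow> (\<Sum>j\<in>J. x j p) = C p"
    "\<And>j p b. j \<in> J \<Longrightarrow> p \<in> K \<Longrightarrow> w j p \<le> D * b \<Longrightarrow> x j p \<le> b"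
    by blast
  have x_le_y: "x j (t, S) \<le> y j t S" if "j \<in> J" "t \<in> T" "S \<in> small_subsets U (h t)" for j t S
  proof -
    have "w j (t, S) \<le> D * y j t S"
    \<comment> \<open>if more places are left than vertices to come, there are no such edges\<close>
    proof (cases "h t - card S \<le> D")
      case False
      with y1 that have "(\<Sum>j\<in>J. y j t S) = 0" by (simp add: binomial_eq_0)
      with fin that have "y j t S = 0" by simp
      then show ?thesis by (simp add: w_def)
    qed (simp add: w_def)
    with that show ?thesis by (intro x(3)) (auto simp: K_def)
  qed
  have x_full: "x j (t, S) = 0" if "j \<in> J" "t \<in> T" "S \<in> small_subsets U (h t)" "\<not> card S < h t" for j t S
    using x(3)[of j "(t, S)" 0] that by (auto simp: K_def w_def)
  define y' where "y' = (\<lambda>j t S. if v \<in> S then x j (t, S - {v}) else y j t S - x j (t, S))"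
  have notin: "v \<notin> S" if "S \<in> small_subsets U k" for S k
    using that v by (auto simp: small_subsets_def)
  have y'_insert: "y' j t (insert v S) = x j (t, S)" and y'_same: "y' j t S = y j t S - x j (t, S)"
    if "S \<in> small_subsets U k" for j t S k
    using notin[OF that] by (auto simp: y'_def)
  \<comment> \<open>weights that ignore \<open>v\<close> see no difference between \<open>y\<close> and \<open>y'\<close>; this covers both the
    totals \<open>e j t\<close> and the degrees of the vertices treated before\<close>
  have weighted: "(\<Sum>S\<in>small_subsets (insert v U) (h t). g S * y' j t S) =
      (\<Sum>S\<in>small_subsets U (h t). g S * y j t S)"
    if jt: "j \<in> J" "t \<in> T" and g: "\<And>S. g (insert v S) = g S" for g j t
  proof -
    have "(\<Sum>S\<in>small_subsets (insert v U) (h t). g S * y' j t S) =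
        (\<Sum>S\<in>small_subsets U (h t). g S * (y j t S - x j (t, S)) + of_bool (card S < h t) * (g S * x j (t, S)))"
      unfolding sum_small_subsets_insert[OF fin(3) v] sum.distrib
      by (intro arg_cong2[of _ _ _ _ "(+)"] sum.cong refl) (auto simp: y'_insert y'_same g)
    also have "\<dots> = (\<Sum>S\<in>small_subsets U (h t). g S * y j t S)"
      using jt x_le_y x_full by (intro sum.cong refl) (auto simp flip: add_mult_distrib2)
    finally show ?thesis .
  qed
  have "(\<Sum>j\<in>J. y' j t S) = \<mu> t * ((N - card (insert v U)) choose (h t - card S))"
    if t: "t \<in> T" and S: "S \<in> small_subsets (insert v U) (h t)" for t S
  proof -
    have D': "N - card (insert v U) = D - 1" using fin v by (simp add: D_def)
    have finS: "finite S" using S fin by (auto simp: small_subsets_def intro: finite_subset)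
    show ?thesis
    proof (cases "v \<in> S")
      case True
      define R where "R = S - {v}"
      have cardR: "card S = Suc (card R)" using card_Suc_Diff1[OF finS True] by (simp add: R_def)
      have R: "R \<in> small_subsets U (h t)" "card R < h t"
        using S cardR by (auto simp: small_subsets_def R_def)
      have "(\<Sum>j\<in>J. y' j t S) = (\<Sum>j\<in>J. x j (t, R))" using True by (simp add: y'_def R_def)
      also have "\<dots> = C (t, R)" using R t by (intro x(2)) (auto simp: K_def)
      finally show ?thesis using R cardR D' by (simp add: C_def)
    next
      case False
      then have R: "S \<in> small_subsets U (h t)" using S by (auto simp: small_subsets_def)
      have "(\<Sum>j\<in>J. y' j t S) + C (t, S) = (\<Sum>j\<in>J. y' j t S) + (\<Sum>j\<in>J. x j (t, S))"
        using R t x(2) by (auto simp: K_def)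
      also have "\<dots> = (\<Sum>j\<in>J. y j t S)"
        using x_le_y t R False unfolding sum.distrib[symmetric]
        by (intro sum.cong refl) (auto simp: y'_def)
      also have "\<dots> = \<mu> t * (D choose (h t - card S))" using y1 t R by simp
      finally have eq: "(\<Sum>j\<in>J. y' j t S) + C (t, S) = \<mu> t * (D choose (h t - card S))" .
      show ?thesis
      proof (cases "card S < h t")
        case True
        have "D choose (h t - card S) = ((D - 1) choose (h t - card S - 1)) + ((D - 1) choose (h t - card S))"
          using True D by (intro choose_reduce_nat) auto
        with eq True D' show ?thesis by (simp add: C_def algebra_simps)
      next
        case False
        with eq D' show ?thesis by (simp add: C_def)
      qed
    qed
  qed
  moreover have "(\<Sum>S\<in>small_subsets (insert v U) (h t). y' j t S) = e j t" if "j \<in> J" "t \<in> T" for j t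
    using weighted[OF that, of "\<lambda>_. 1"] y2 that by simp
  moreover have "(\<Sum>t\<in>T. \<Sum>S\<in>small_subsets (insert v U) (h t). of_bool (u \<in> S) * y' j t S) = d j"
    if j: "j \<in> J" and u: "u \<in> insert v U" for j u
  proof (cases "u = v")
    case False
    then have "(\<Sum>t\<in>T. \<Sum>S\<in>small_subsets (insert v U) (h t). of_bool (u \<in> S) * y' j t S) =
        (\<Sum>t\<in>T. \<Sum>S\<in>small_subsets U (h t). of_bool (u \<in> S) * y j t S)"
      using weighted[OF j, of _ "\<lambda>S. of_bool (u \<in> S)"] by simp
    with False u y3[OF j] show ?thesis by simp
  next
    case True
    have "(\<Sum>S\<in>small_subsets (insert v U) (h t). of_bool (u \<in> S) * y' j t S) =
        (\<Sum>S\<in>small_subsets U (h t). x j (t, S))" if t: "t \<in> T" for t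
    proof -
      have "(\<Sum>S\<in>small_subsets U (h t). of_bool (v \<in> S) * y' j t S) = 0"
        using notin by (intro sum.neutral) auto
      moreover have "(\<Sum>S\<in>small_subsets U (h t). of_bool (card S < h t) * y' j t (insert v S)) =
          (\<Sum>S\<in>small_subsets U (h t). x j (t, S))"
        using x_full[OF j t] by (intro sum.cong refl) (auto simp: y'_insert)
      ultimately show ?thesis
        unfolding True sum_small_subsets_insert[OF fin(3) v] by simp
    qed
    then have "(\<Sum>t\<in>T. \<Sum>S\<in>small_subsets (insert v U) (h t). of_bool (u \<in> S) * y' j t S) =
        (\<Sum>p\<in>K. x j p)"
      using fin finS by (simp add: K_def sum.Sigma)
    with x(1)[OF j] show ?thesis by simp
  qed
  ultimately show ?thesis unfolding partial_detachment_def by blast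
qed

text \<open>After the last vertex, the binomial coefficient \<open>0 choose (h t - card S)\<close> in the invariant leaves only
  complete edges. For a single type of multiplicity one this is Baranyai's theorem for regular color classes.\<close>

lemma regular_detachment:
  fixes V :: "'b set" and e :: "'j \<Rightarrow> 't \<Rightarrow> nat"
  assumes fin: "finite J" "finite T" "finite V"
    and total: "\<And>t. t \<in> T \<Longrightarrow> (\<Sum>j\<in>J. e j t) = \<mu> t * (card V choose h t)"
    and deg: "\<And>j. j \<in> J \<Longrightarrow> (\<Sum>t\<in>T. h t * e j t) = card V * d j"
  shows "\<exists>y :: 'j \<Rightarrow> 't \<Rightarrow> 'b set \<Rightarrow> nat.
    (\<forall>t\<in>T. \<forall>S. S \<subseteq> V \<and> card S = h t \<longrightarrow> (\<Sum>j\<in>J. y j t S) = \<mu> t) \<and>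
    (\<forall>j\<in>J. \<forall>t\<in>T. (\<Sum>S | S \<subseteq> V \<and> card S = h t. y j t S) = e j t) \<and>
    (\<forall>j\<in>J. \<forall>v\<in>V. (\<Sum>t\<in>T. \<Sum>S | S \<subseteq> V \<and> card S = h t. of_bool (v \<in> S) * y j t S) = d j)"
proof -
  have "\<exists>y. partial_detachment J T h \<mu> e d (card V) U y" if "finite U" "U \<subseteq> V" for U
    using that
  proof (induction rule: finite_induct)
    case empty
    have "small_subsets ({} :: 'b set) k = {{}}" for k by (auto simp: small_subsets_def)
    then have "partial_detachment J T h \<mu> e d (card V) ({} :: 'b set) (\<lambda>j t S. e j t)"
      using total by (simp add: partial_detachment_def)
    then show ?case by blast
  next
    case (insert v U)
    then obtain y where y: "partial_detachment J T h \<mu> e d (card V) U y" by auto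
    have "card U < card V" using insert fin by (intro psubset_card_mono) auto
    from partial_detachment_step[OF fin(1,2) insert.hyps(1,2) this deg y] show ?case by simp
  qed
  from this[OF fin(3)] obtain y where y: "partial_detachment J T h \<mu> e d (card V) V y" by auto
  have y1: "(\<Sum>j\<in>J. y j t S) = \<mu> t * (0 choose (h t - card S))"
    if "t \<in> T" "S \<in> small_subsets V (h t)" for t S
    using y that by (simp add: partial_detachment_def)
  have restrict: "(\<Sum>S | S \<subseteq> V \<and> card S = h t. g S * y j t S) =
      (\<Sum>S\<in>small_subsets V (h t). g S * y j t S)" if "j \<in> J" "t \<in> T" for g j t
  proof (intro sum.mono_neutral_left ballI)
    fix S assume S: "S \<in> small_subsets V (h t) - {S. S \<subseteq> V \<and> card S = h t}"
    then have "card S < h t" by (auto simp: small_subsets_def)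
    with S y1 that have "(\<Sum>j\<in>J. y j t S) = 0" by (simp add: binomial_eq_0)
    with that fin show "g S * y j t S = 0" by simp
  qed (use fin in \<open>auto simp: finite_small_subsets small_subsets_def\<close>)
  show ?thesis
  proof (intro exI[of _ y] conjI ballI allI impI)
    fix t S assume "t \<in> T" "S \<subseteq> V \<and> card S = h t"
    then show "(\<Sum>j\<in>J. y j t S) = \<mu> t" using y1 by (simp add: small_subsets_def)
  next
    fix j t assume "j \<in> J" "t \<in> T"
    then show "(\<Sum>S | S \<subseteq> V \<and> card S = h t. y j t S) = e j t"
      using restrict[of j t "\<lambda>_. 1"] y by (simp add: partial_detachment_def)
  next
    fix j v assume "j \<in> J" "v \<in> V"
    then show "(\<Sum>t\<in>T. \<Sum>S | S \<subseteq> V \<and> card S = h t. of_bool (v \<in> S) * y j t S) = d j"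
      using y by (simp add: partial_detachment_def restrict)
  qed
qed

section \<open>Choosing how many edges of each type a color gets\<close>

text \<open>One of \<open>q\<close> nearly equal integral shares of \<open>F\<close>, for \<open>j\<close> in \<open>{1..q}\<close>. The larger shares always go to the
  first colors; this makes the share of each single color monotone in \<open>F\<close>.\<close>

definition balanced_share :: "nat \<Rightarrow> nat \<Rightarrow> nat \<Rightarrow> nat" where
  "balanced_share q F j = F div q + of_bool (j \<le> F mod q)"

lemma sum_balanced_share:
  assumes "q > 0"
  shows "(\<Sum>j=1..q. balanced_share q F j) = F"
proof -
  have "(\<Sum>j=1..q. of_bool (j \<le> F mod q)) = (\<Sum>j=1..F mod q. 1 :: nat)"
    using mod_less_divisor[OF assms, of F] by (intro sum.mono_neutral_cong_right) auto
  then show ?thesis by (simp add: balanced_share_def sum.distrib)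
qed

lemma balanced_share_bounds:
  assumes "q > 0" "j \<ge> 1"
  shows "q * balanced_share q F j < F + q" "F < q * balanced_share q F j + q"
proof -
  have F: "F = q * (F div q) + F mod q" and "F mod q < q" using assms by simp_all
  have "q * balanced_share q F j = q * (F div q) + q * of_bool (j \<le> F mod q)"
    by (simp add: balanced_share_def add_mult_distrib2)
  with F \<open>F mod q < q\<close> assms
  show "q * balanced_share q F j < F + q" "F < q * balanced_share q F j + q"
    by (cases "j \<le> F mod q"; simp; linarith)+
qed

lemma balanced_share_mono:
  assumes "F \<le> G"
  shows "balanced_share q F j \<le> balanced_share q G j"
proof (cases "F div q = G div q")
  case True
  then have "F mod q \<le> G mod q"
    using assms by (metis add_le_cancel_left mult_div_mod_eq)
  with True show ?thesis by (auto simp: balanced_share_def)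
next
  case False
  then have "Suc (F div q) \<le> G div q" using div_le_mono[OF assms, of q] by simp
  then show ?thesis by (auto simp: balanced_share_def)
qed

text \<open>The two equations for color \<open>j\<close> give \<open>e j 2 = 3 M - A - 2 (e j 0 + e j 1) - e j 0\<close> and
  \<open>e j 3 = A - 2 M + (e j 0 + e j 1) + e j 0\<close>. These expressions are linear in \<open>e j 0\<close> and
  \<open>e j 0 + e j 1\<close>, each of which deviates from its average by less than \<open>1\<close>, so they deviate
  from the averages \<open>t 2 / q\<close> and \<open>t 3 / q\<close> by less than \<open>3\<close> and less than \<open>2\<close>. Sharing \<open>e j 0 + e j 1\<close>
  rather than \<open>e j 1\<close> itself evenly is what keeps these deviations small.\<close>

lemma equitable_type_distribution:
  fixes t :: "nat \<Rightarrow> nat"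
  assumes q: "q > 0"
    and size: "(\<Sum>i<4. t i) = q * M"
    and deg: "(\<Sum>i<4. i * t i) = q * A"
    and large: "t 2 \<ge> 2 * q" "t 3 \<ge> q"
  shows "\<exists>e. (\<forall>i\<in>{..<4}. (\<Sum>j=1..q. e j i) = t i) \<and>
    (\<forall>j\<in>{1..q}. (\<Sum>i<4. e j i) = M \<and> (\<Sum>i<4. i * e j i) = A)"
proof -
  have size': "int (t 0) + int (t 1) + int (t 2) + int (t 3) = int q * int M"
  proof -
    have "t 0 + t 1 + t 2 + t 3 = q * M" using size by (simp add: numeral_eq_Suc)
    then have "int (t 0 + t 1 + t 2 + t 3) = int (q * M)" by (rule arg_cong)
    then show ?thesis by (simp only: of_nat_add of_nat_mult)
  qed
  have deg': "int (t 1) + 2 * int (t 2) + 3 * int (t 3) = int q * int A"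
  proof -
    have "t 1 + 2 * t 2 + 3 * t 3 = q * A" using deg by (simp add: numeral_eq_Suc)
    then have "int (t 1 + 2 * t 2 + 3 * t 3) = int (q * A)" by (rule arg_cong)
    then show ?thesis by (simp only: of_nat_add of_nat_mult of_nat_numeral)
  qed
  define z where "z = balanced_share q (t 0)"
  define f where "f = balanced_share q (t 0 + t 1)"
  have z_le_f: "z j \<le> f j" for j unfolding z_def f_def by (rule balanced_share_mono) simp
  \<comment> \<open>integer-valued until they are known to be nonnegative\<close>
  define e2 where "e2 j = 3 * int M - int A - 2 * int (f j) - int (z j)" for j
  define e3 where "e3 j = int A - 2 * int M + int (f j) + int (z j)" for j
  have zb: "int q * int (z j) \<le> int (t 0) + int q - 1" "int (t 0) \<le> int q * int (z j) + int q - 1"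
    if "j \<ge> 1" for j
    using balanced_share_bounds[OF q that, of "t 0"] unfolding z_def of_nat_mult[symmetric] by linarith+
  have fb: "int q * int (f j) \<le> int (t 0) + int (t 1) + int q - 1"
    "int (t 0) + int (t 1) \<le> int q * int (f j) + int q - 1" if "j \<ge> 1" for j
    using balanced_share_bounds[OF q that, of "t 0 + t 1"] unfolding f_def of_nat_mult[symmetric] by linarith+
  have e2: "e2 j \<ge> 0" if j: "j \<ge> 1" for j
  proof -
    have "int q * e2 j = 3 * (int q * int M) - int q * int A - 2 * (int q * int (f j)) - int q * int (z j)"
      by (simp add: e2_def algebra_simps)
    \<comment> \<open>a linear problem once the products with \<open>q\<close> are treated as unknowns\<close>
    moreover have "- k < 3 * x - y - 2 * u - v"
      if "a0 + a1 + a2 + a3 = x" "a1 + 2 * a2 + 3 * a3 = y" "v \<le> a0 + k - 1" "u \<le> a0 + a1 + k - 1"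
        "2 * k \<le> a2" for a0 a1 a2 a3 x y u v k :: int
      using that by linarith
    note this[OF size' deg' zb(1)[OF j] fb(1)[OF j]]
    ultimately have "int q * (- 1) < int q * e2 j" using large(1) by simp
    then have "e2 j > - 1" using q by (subst (asm) mult_less_cancel_left_pos) auto
    then show ?thesis by simp
  qed
  have e3: "e3 j \<ge> 0" if j: "j \<ge> 1" for j
  proof -
    have "int q * e3 j = int q * int A - 2 * (int q * int M) + int q * int (f j) + int q * int (z j)"
      by (simp add: e3_def algebra_simps)
    moreover have "- k < y - 2 * x + u + v"
      if "a0 + a1 + a2 + a3 = x" "a1 + 2 * a2 + 3 * a3 = y" "a0 \<le> v + k - 1" "a0 + a1 \<le> u + k - 1"
        "k \<le> a3" for a0 a1 a2 a3 x y u v k :: int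
      using that by linarith
    note this[OF size' deg' zb(2)[OF j] fb(2)[OF j]]
    ultimately have "int q * (- 1) < int q * e3 j" using large(2) by simp
    then have "e3 j > - 1" using q by (subst (asm) mult_less_cancel_left_pos) auto
    then show ?thesis by simp
  qed
  define e where "e = (\<lambda>j (i :: nat). if i = 0 then z j else if i = 1 then f j - z j
    else if i = 2 then nat (e2 j) else nat (e3 j))"
  have sum_z: "(\<Sum>j=1..q. z j) = t 0" and sum_f: "(\<Sum>j=1..q. f j) = t 0 + t 1"
    unfolding z_def f_def by (rule sum_balanced_share[OF q])+
  have sum_e0: "(\<Sum>j=1..q. e j 0) = t 0" using sum_z by (simp add: e_def)
  have "(\<Sum>j=1..q. e j 1) + (\<Sum>j=1..q. z j) = (\<Sum>j=1..q. f j)"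
    using z_le_f by (simp add: e_def flip: sum.distrib)
  then have sum_e1: "(\<Sum>j=1..q. e j 1) = t 1" using sum_z sum_f by simp
  have sum_zf: "(\<Sum>j=1..q. int (z j)) = int (t 0)" "(\<Sum>j=1..q. int (f j)) = int (t 0) + int (t 1)"
    using sum_z sum_f by (simp_all flip: of_nat_sum)
  have "int (\<Sum>j=1..q. e j 2) = (\<Sum>j=1..q. e2 j)" using e2 by (simp add: e_def)
  also have "\<dots> = int q * (3 * int M - int A) - 2 * (int (t 0) + int (t 1)) - int (t 0)"
    using sum_zf by (simp add: e2_def sum_subtractf flip: sum_distrib_left)
  also have "\<dots> = int (t 2)" using size' deg' by (simp add: algebra_simps)
  finally have sum_e2: "(\<Sum>j=1..q. e j 2) = t 2" by linarith
  have "int (\<Sum>j=1..q. e j 3) = (\<Sum>j=1..q. e3 j)" using e3 by (simp add: e_def)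
  also have "\<dots> = int q * (int A - 2 * int M) + (int (t 0) + int (t 1)) + int (t 0)"
    using sum_zf by (simp add: e3_def sum.distrib sum_subtractf)
  also have "\<dots> = int (t 3)" using size' deg' by (simp add: algebra_simps)
  finally have sum_e3: "(\<Sum>j=1..q. e j 3) = t 3" by linarith
  have "(\<Sum>j=1..q. e j i) = t i" if "i < 4" for i
  proof -
    from that consider "i = 0" | "i = 1" | "i = 2" | "i = 3" by linarith
    then show ?thesis using sum_e0 sum_e1 sum_e2 sum_e3 by cases simp_all
  qed
  moreover have "(\<Sum>i<4. e j i) = M" if j: "j \<ge> 1" for j
  proof -
    have "(\<Sum>i<4. e j i) = z j + (f j - z j) + nat (e2 j) + nat (e3 j)"
      by (simp add: numeral_eq_Suc e_def)
    then show ?thesis using z_le_f[of j] e2[OF j] e3[OF j] by (simp add: e2_def e3_def)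
  qed
  moreover have "(\<Sum>i<4. i * e j i) = A" if j: "j \<ge> 1" for j
  proof -
    have "(\<Sum>i<4. i * e j i) = (f j - z j) + 2 * nat (e2 j) + 3 * nat (e3 j)"
      by (simp add: numeral_eq_Suc e_def)
    then show ?thesis using z_le_f[of j] e2[OF j] e3[OF j] by (simp add: e2_def e3_def)
  qed
  ultimately show ?thesis by (intro exI[of _ e]) simp
qed

section \<open>Colorings and multiplicities\<close>

lemma ex_map_with_fibre_cards:
  assumes "finite J" "finite I" "(\<Sum>j\<in>J. f j) = card I"
  shows "\<exists>g. g \<in> I \<rightarrow> J \<and> (\<forall>j\<in>J. card {i \<in> I. g i = j} = f j)"
  using assms
proof (induction J arbitrary: I rule: finite_induct)
  case empty
  then show ?case by auto
next
  case (insert j J)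
  then have "f j \<le> card I" by simp
  then obtain K where K: "K \<subseteq> I" "card K = f j" "finite K" by (rule obtain_subset_with_card_n)
  then have "(\<Sum>j\<in>J. f j) = card (I - K)" using insert by (simp add: card_Diff_subset)
  with insert obtain g where g: "g \<in> I - K \<rightarrow> J" "\<forall>j\<in>J. card {i \<in> I - K. g i = j} = f j"
    by (metis finite_Diff)
  define g' where "g' i = (if i \<in> K then j else g i)" for i
  have "{i \<in> I. g' i = j} = K" using g(1) K insert.hyps by (auto simp: g'_def)
  moreover have "{i \<in> I. g' i = j'} = {i \<in> I - K. g i = j'}" if "j' \<in> J" for j'
    using that insert.hyps by (auto simp: g'_def)
  moreover have "g' \<in> I \<rightarrow> insert j J" using g(1) by (auto simp: g'_def Pi_iff)
  ultimately show ?case using K(2) g(2) by (intro exI[of _ g']) auto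
qed

definition copies :: "nat \<Rightarrow> (nat set \<times> nat \<Rightarrow> nat) \<Rightarrow> nat \<Rightarrow> nat set \<Rightarrow> nat" where
  "copies lam c j S = card {i \<in> {1..lam}. c (S, i) = j}"

lemma degree_in_color_class:
  "degree_in (color_class lam m h c j) v =
    (\<Sum>S | S \<subseteq> {1..m} \<and> card S = h. of_bool (v \<in> S) * copies lam c j S)"
proof -
  have fin: "finite {S. S \<subseteq> {1..m} \<and> card S = h}"
    by (rule finite_subset[of _ "Pow {1..m}"]) auto
  have "{e \<in> color_class lam m h c j. v \<in> fst e} =
      (SIGMA S:{S. S \<subseteq> {1..m} \<and> card S = h}. {i \<in> {1..lam}. v \<in> S \<and> c (S, i) = j})"
    by (auto simp: color_class_def hyp_edges_def)
  then have "degree_in (color_class lam m h c j) v =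
      (\<Sum>S | S \<subseteq> {1..m} \<and> card S = h. card {i \<in> {1..lam}. v \<in> S \<and> c (S, i) = j})"
    using fin by (simp add: degree_in_def)
  also have "\<dots> = (\<Sum>S | S \<subseteq> {1..m} \<and> card S = h. of_bool (v \<in> S) * copies lam c j S)"
    by (rule sum.cong[OF refl]) (simp add: copies_def)
  finally show ?thesis .
qed

lemma sum_copies:
  assumes "is_coloring lam m h q c" "S \<subseteq> {1..m}" "card S = h"
  shows "(\<Sum>j=1..q. copies lam c j S) = lam"
proof -
  have "(\<Sum>j\<in>{1..q}. \<Sum>i | i \<in> {1..lam} \<and> c (S, i) = j. 1) = (\<Sum>i\<in>{1..lam}. 1 :: nat)"
    using assms by (intro sum.group) (auto simp: is_coloring_def hyp_edges_def)
  then show ?thesis by (simp add: copies_def)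
qed

lemma factorization_double_count:
  assumes "is_factorization r lam m h q c" "j \<in> {1..q}"
  shows "h * (\<Sum>S | S \<subseteq> {1..m} \<and> card S = h. copies lam c j S) = r * m"
proof -
  let ?A = "{S. S \<subseteq> {1..m} \<and> card S = h}"
  have "r * m = (\<Sum>v\<in>{1..m}. degree_in (color_class lam m h c j) v)"
    using assms by (simp add: is_factorization_def)
  also have "\<dots> = (\<Sum>S\<in>?A. card S * copies lam c j S)"
    unfolding degree_in_color_class by (rule sum_card_double_count[symmetric]) auto
  also have "\<dots> = h * (\<Sum>S\<in>?A. copies lam c j S)"
    unfolding sum_distrib_left by (rule sum.cong) auto
  finally show ?thesis by simp
qed

lemma factorization_colors:
  assumes fac: "is_factorization r lam m h q c"
  shows "q * (r * m) = h * (lam * (m choose h))"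
proof -
  let ?A = "{S. S \<subseteq> {1..m} \<and> card S = h}"
  have "q * (r * m) = (\<Sum>j=1..q. h * (\<Sum>S\<in>?A. copies lam c j S))"
    using factorization_double_count[OF fac] by simp
  also have "\<dots> = h * (\<Sum>S\<in>?A. \<Sum>j=1..q. copies lam c j S)"
    unfolding sum_distrib_left[symmetric] by (subst sum.swap) (rule refl)
  also have "(\<Sum>S\<in>?A. \<Sum>j=1..q. copies lam c j S) = (\<Sum>S\<in>?A. lam)"
    using fac by (intro sum.cong[OF refl] sum_copies) (auto simp: is_factorization_def)
  finally show ?thesis by (simp add: n_subsets mult.commute)
qed

section \<open>Extending a factorization with prescribed type counts\<close>

lemma sum_small_subsets_by_card:
  fixes g :: "'b set \<Rightarrow> nat"
  assumes "finite V"
  shows "(\<Sum>S\<in>small_subsets V h. g S) =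
    (\<Sum>i<h. \<Sum>S | S \<subseteq> V \<and> card S = i. g S) + (\<Sum>S | S \<subseteq> V \<and> card S = h. g S)"
proof -
  have "(\<Sum>S\<in>small_subsets V h. g S) = (\<Sum>i\<in>{..h}. \<Sum>S | S \<in> small_subsets V h \<and> card S = i. g S)"
    using assms by (intro sum.group[symmetric]) (auto simp: finite_small_subsets small_subsets_def)
  also have "\<dots> = (\<Sum>i\<in>{..h}. \<Sum>S | S \<subseteq> V \<and> card S = i. g S)"
    by (rule sum.cong[OF refl], rule sum.cong) (auto simp: small_subsets_def)
  finally show ?thesis by (simp flip: lessThan_Suc_atMost)
qed

lemma card_Int_disjoint_cover:
  assumes "finite V" "finite W" "V \<inter> W = {}" "X \<subseteq> V \<union> W"
  shows "card (X \<inter> V) + card (X \<inter> W) = card X"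
proof -
  have "finite X" using finite_subset[OF assms(4)] assms(1,2) by simp
  then have "card ((X \<inter> V) \<union> (X \<inter> W)) = card (X \<inter> V) + card (X \<inter> W)"
    using assms(3) by (intro card_Un_disjoint) auto
  moreover have "(X \<inter> V) \<union> (X \<inter> W) = X" using assms(4) by blast
  ultimately show ?thesis by simp
qed

lemma sum_subsets_disjoint_union:
  fixes g :: "'b set \<Rightarrow> 'b set \<Rightarrow> nat"
  assumes fin: "finite V" "finite W" and disj: "V \<inter> W = {}"
  shows "(\<Sum>X | X \<subseteq> V \<union> W \<and> card X = h. g (X \<inter> V) (X \<inter> W)) =
    (\<Sum>S\<in>small_subsets V h. \<Sum>R | R \<subseteq> W \<and> card R = h - card S. g S R)"
proof -
  let ?R = "\<lambda>S. {R. R \<subseteq> W \<and> card R = h - card S}"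
  let ?P = "SIGMA S:small_subsets V h. ?R S"
  note card_split = card_Int_disjoint_cover[OF fin disj]
  have card_join: "card (S \<union> R) = h" if "(S, R) \<in> ?P" for S R
  proof -
    have SR: "S \<subseteq> V" "card S \<le> h" "R \<subseteq> W" "card R = h - card S"
      using that by (auto simp: small_subsets_def)
    then have "finite S" "finite R" "S \<inter> R = {}" using fin disj by (auto intro: finite_subset)
    then have "card (S \<union> R) = card S + card R" by (rule card_Un_disjoint)
    with SR show ?thesis by simp
  qed
  have "(\<Sum>p\<in>?P. g (fst p) (snd p)) = (\<Sum>X | X \<subseteq> V \<union> W \<and> card X = h. g (X \<inter> V) (X \<inter> W))"
  proof (rule sum.reindex_bij_witness[where i = "\<lambda>X. (X \<inter> V, X \<inter> W)" and j = "\<lambda>p. fst p \<union> snd p"])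
    fix p assume p: "p \<in> ?P"
    obtain S R where SR: "p = (S, R)" by fastforce
    with p have sub: "S \<subseteq> V" "R \<subseteq> W" by (auto simp: small_subsets_def)
    then have int: "(S \<union> R) \<inter> V = S" "(S \<union> R) \<inter> W = R" using disj by blast+
    then show "((fst p \<union> snd p) \<inter> V, (fst p \<union> snd p) \<inter> W) = p" by (simp add: SR)
    show "fst p \<union> snd p \<in> {X. X \<subseteq> V \<union> W \<and> card X = h}"
      using card_join[of S R] p sub by (auto simp: SR)
    show "g ((fst p \<union> snd p) \<inter> V) ((fst p \<union> snd p) \<inter> W) = g (fst p) (snd p)"
      using int by (simp add: SR)
  next
    fix X assume X: "X \<in> {X. X \<subseteq> V \<union> W \<and> card X = h}"
    then show "fst (X \<inter> V, X \<inter> W) \<union> snd (X \<inter> V, X \<inter> W) = X" by auto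
    have "card (X \<inter> V) \<le> h" "card (X \<inter> W) = h - card (X \<inter> V)" using card_split[of X] X by auto
    then show "(X \<inter> V, X \<inter> W) \<in> ?P" by (auto simp: small_subsets_def)
  qed
  moreover have "(\<Sum>p\<in>?P. g (fst p) (snd p)) = (\<Sum>S\<in>small_subsets V h. \<Sum>R\<in>?R S. g S R)"
  proof -
    have "\<forall>S\<in>small_subsets V h. finite (?R S)"
      using fin by (auto intro: finite_subset[of _ "Pow W"])
    then show ?thesis using fin by (simp add: sum.Sigma finite_small_subsets case_prod_unfold)
  qed
  ultimately show ?thesis by simp
qed

text \<open>The edges inside \<open>{1..m}\<close> keep their colors. The others are first spread over the old vertices
  \<open>V\<close>, with the types \<open>i < h\<close> and \<open>i\<close> places to fill; an edge of type \<open>i\<close> then has one of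
  \<open>(n - m) choose (h - i)\<close> possible new parts, which is why this number enters the multiplicities. Then they
  are spread over the new vertices \<open>W\<close>, where the type of an edge is its old part \<open>S\<close>, which leaves
  \<open>h - card S\<close> places to fill. The old edges take part in the second step as types without free
  places.\<close>

lemma extension_from_type_counts:
  fixes c :: "nat set \<times> nat \<Rightarrow> nat"
  assumes fac: "is_factorization r lam m h q c" and le: "m \<le> n" "r \<le> s"
    and total: "\<And>i. i < h \<Longrightarrow> (\<Sum>j=1..q. e j i) = lam * (m choose i) * ((n - m) choose (h - i))"
    and old: "\<And>j. j \<in> {1..q} \<Longrightarrow> (\<Sum>i<h. i * e j i) = m * (s - r)"
    and new: "\<And>j. j \<in> {1..q} \<Longrightarrow> (\<Sum>i<h. (h - i) * e j i) = (n - m) * s"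
  shows "\<exists>c'. is_factorization s lam n h q c' \<and> (\<forall>p\<in>hyp_edges lam m h. c' p = c p)"
proof -
  define V where "V = {1..m}"
  define W where "W = {m + 1..n}"
  have VW: "V \<union> W = {1..n}" "V \<inter> W = {}" "finite V" "finite W" "card V = m" "card W = n - m"
    using le by (auto simp: V_def W_def)
  have col: "is_coloring lam m h q c" using fac by (simp add: is_factorization_def)
  \<comment> \<open>\<open>y j i S\<close> edges of type \<open>i\<close> and color \<open>j\<close> get the old part \<open>S\<close>\<close>
  have "\<exists>y :: nat \<Rightarrow> nat \<Rightarrow> nat set \<Rightarrow> nat.
    (\<forall>i\<in>{..<h}. \<forall>S. S \<subseteq> V \<and> card S = i \<longrightarrow> (\<Sum>j\<in>{1..q}. y j i S) = lam * ((n - m) choose (h - i))) \<and>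
    (\<forall>j\<in>{1..q}. \<forall>i\<in>{..<h}. (\<Sum>S | S \<subseteq> V \<and> card S = i. y j i S) = e j i) \<and>
    (\<forall>j\<in>{1..q}. \<forall>v\<in>V. (\<Sum>i\<in>{..<h}. \<Sum>S | S \<subseteq> V \<and> card S = i. of_bool (v \<in> S) * y j i S) = s - r)"
    using total old VW by (intro regular_detachment) (simp_all add: mult.commute mult.left_commute)
  then obtain y :: "nat \<Rightarrow> nat \<Rightarrow> nat set \<Rightarrow> nat" where
    y1: "\<forall>i\<in>{..<h}. \<forall>S. S \<subseteq> V \<and> card S = i \<longrightarrow> (\<Sum>j\<in>{1..q}. y j i S) = lam * ((n - m) choose (h - i))"
    and y2: "\<forall>j\<in>{1..q}. \<forall>i\<in>{..<h}. (\<Sum>S | S \<subseteq> V \<and> card S = i. y j i S) = e j i"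
    and y3: "\<forall>j\<in>{1..q}. \<forall>v\<in>V. (\<Sum>i\<in>{..<h}. \<Sum>S | S \<subseteq> V \<and> card S = i. of_bool (v \<in> S) * y j i S) = s - r"
    by (elim exE conjE)
  define a where "a j S = (if card S = h then copies lam c j S else y j (card S) S)" for j S
  have a_by_card: "(\<Sum>S\<in>small_subsets V h. g S * a j S) =
      (\<Sum>i<h. \<Sum>S | S \<subseteq> V \<and> card S = i. g S * y j i S) +
      (\<Sum>S | S \<subseteq> V \<and> card S = h. g S * copies lam c j S)" for g :: "nat set \<Rightarrow> nat" and j
    unfolding sum_small_subsets_by_card[OF VW(3)]
    by (intro arg_cong2[where f = "(+)"] sum.cong[OF refl]) (auto simp: a_def)
  have a_total: "(\<Sum>j\<in>{1..q}. a j S) = lam * (card W choose (h - card S))"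
    if S: "S \<in> small_subsets V h" for S
  proof (cases "card S = h")
    case True
    then show ?thesis using S sum_copies[OF col, of S] by (simp add: a_def V_def small_subsets_def)
  next
    case False
    then show ?thesis using S y1 VW(6) by (simp add: a_def small_subsets_def)
  qed
  have a_new: "(\<Sum>S\<in>small_subsets V h. (h - card S) * a j S) = card W * s" if j: "j \<in> {1..q}" for j
  proof -
    have "(\<Sum>S\<in>small_subsets V h. (h - card S) * a j S) =
        (\<Sum>i<h. \<Sum>S | S \<subseteq> V \<and> card S = i. (h - card S) * y j i S)"
      unfolding a_by_card by simp
    also have "\<dots> = (\<Sum>i<h. (h - i) * (\<Sum>S | S \<subseteq> V \<and> card S = i. y j i S))"
      unfolding sum_distrib_left by (intro sum.cong[OF refl]) simp
    also have "\<dots> = (\<Sum>i<h. (h - i) * e j i)" using y2 j by simp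
    finally show ?thesis using new[OF j] VW(6) by simp
  qed
  \<comment> \<open>of the \<open>a j S\<close> edges with old part \<open>S\<close>, \<open>z j S R\<close> get the new part \<open>R\<close>\<close>
  have "\<exists>z :: nat \<Rightarrow> nat set \<Rightarrow> nat set \<Rightarrow> nat.
    (\<forall>S\<in>small_subsets V h. \<forall>R. R \<subseteq> W \<and> card R = h - card S \<longrightarrow> (\<Sum>j\<in>{1..q}. z j S R) = lam) \<and>
    (\<forall>j\<in>{1..q}. \<forall>S\<in>small_subsets V h. (\<Sum>R | R \<subseteq> W \<and> card R = h - card S. z j S R) = a j S) \<and>
    (\<forall>j\<in>{1..q}. \<forall>v\<in>W. (\<Sum>S\<in>small_subsets V h. \<Sum>R | R \<subseteq> W \<and> card R = h - card S. of_bool (v \<in> R) * z j S R) = s)"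
    by (rule regular_detachment) (use VW in \<open>simp_all only: finite_small_subsets a_total a_new finite_atLeastAtMost\<close>)
  then obtain z :: "nat \<Rightarrow> nat set \<Rightarrow> nat set \<Rightarrow> nat" where
    z1: "\<forall>S\<in>small_subsets V h. \<forall>R. R \<subseteq> W \<and> card R = h - card S \<longrightarrow> (\<Sum>j\<in>{1..q}. z j S R) = lam"
    and z2: "\<forall>j\<in>{1..q}. \<forall>S\<in>small_subsets V h. (\<Sum>R | R \<subseteq> W \<and> card R = h - card S. z j S R) = a j S"
    and z3: "\<forall>j\<in>{1..q}. \<forall>v\<in>W. (\<Sum>S\<in>small_subsets V h. \<Sum>R | R \<subseteq> W \<and> card R = h - card S. of_bool (v \<in> R) * z j S R) = s"
    by (elim exE conjE)
  define f where "f j X = z j (X \<inter> V) (X \<inter> W)" for j X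
  let ?E = "{X. X \<subseteq> V \<union> W \<and> card X = h}"
  have "\<exists>g. g \<in> {1..lam} \<rightarrow> {1..q} \<and> (\<forall>j\<in>{1..q}. card {i \<in> {1..lam}. g i = j} = f j X)"
    if X: "X \<in> ?E" for X
  proof (rule ex_map_with_fibre_cards)
    have "card (X \<inter> V) + card (X \<inter> W) = h"
      using card_Int_disjoint_cover[OF VW(3,4,2)] X by simp
    then have "X \<inter> V \<in> small_subsets V h" "X \<inter> W \<subseteq> W \<and> card (X \<inter> W) = h - card (X \<inter> V)"
      by (auto simp: small_subsets_def)
    with z1 show "(\<Sum>j\<in>{1..q}. f j X) = card {1..lam}" by (simp add: f_def)
  qed simp_all
  then have "\<forall>X\<in>?E. \<exists>g. g \<in> {1..lam} \<rightarrow> {1..q} \<and> (\<forall>j\<in>{1..q}. card {i \<in> {1..lam}. g i = j} = f j X)"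
    by (rule ballI)
  from bchoice[OF this] obtain G where
    G: "\<forall>X\<in>?E. G X \<in> {1..lam} \<rightarrow> {1..q} \<and> (\<forall>j\<in>{1..q}. card {i \<in> {1..lam}. G X i = j} = f j X)"
    by (elim exE)
  define c' where "c' = (\<lambda>(X, i). if X \<subseteq> V then c (X, i) else G X i)"
  have copies': "copies lam c' j X = f j X" if X: "X \<in> ?E" and j: "j \<in> {1..q}" for j X
  proof (cases "X \<subseteq> V")
    case False
    then show ?thesis using bspec[OF G X] j by (simp add: copies_def c'_def)
  next
    case True
    then have XV: "X \<inter> V = X" "X \<inter> W = {}" using VW(2) by auto
    have rest: "{R. R \<subseteq> W \<and> card R = h - card X} = {{}}"
      using X VW(4) by (auto dest: finite_subset)
    have "X \<in> small_subsets V h" using True X by (simp add: small_subsets_def)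
    from bspec[OF bspec[OF z2 j] this] have "z j X {} = a j X" unfolding rest by simp
    with True X XV show ?thesis by (simp add: copies_def c'_def f_def a_def)
  qed
  have "degree_in (color_class lam n h c' j) v = s" if j: "j \<in> {1..q}" and v: "v \<in> {1..n}" for j v
  proof -
    have "degree_in (color_class lam n h c' j) v = (\<Sum>X\<in>?E. of_bool (v \<in> X) * f j X)"
      unfolding degree_in_color_class VW(1)[symmetric] using copies' j by simp
    also have "\<dots> = (\<Sum>X\<in>?E. of_bool (v \<in> (X \<inter> V) \<or> v \<in> (X \<inter> W)) * z j (X \<inter> V) (X \<inter> W))"
      using v VW(1) by (intro sum.cong[OF refl]) (auto simp: f_def)
    also have "\<dots> = (\<Sum>S\<in>small_subsets V h. \<Sum>R | R \<subseteq> W \<and> card R = h - card S. of_bool (v \<in> S \<or> v \<in> R) * z j S R)"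
      by (rule sum_subsets_disjoint_union[OF VW(3,4,2), of "\<lambda>S R. of_bool (v \<in> S \<or> v \<in> R) * z j S R"])
    also have "\<dots> = s"
    proof (cases "v \<in> V")
      case True
      then have "v \<notin> W" using VW(2) by blast
      then have "(\<Sum>S\<in>small_subsets V h. \<Sum>R | R \<subseteq> W \<and> card R = h - card S. of_bool (v \<in> S \<or> v \<in> R) * z j S R) =
          (\<Sum>S\<in>small_subsets V h. of_bool (v \<in> S) * (\<Sum>R | R \<subseteq> W \<and> card R = h - card S. z j S R))"
        unfolding sum_distrib_left by (intro sum.cong[OF refl]) auto
      also have "\<dots> = (\<Sum>S\<in>small_subsets V h. of_bool (v \<in> S) * a j S)" using z2 j by simp
      also have "\<dots> = (s - r) + degree_in (color_class lam m h c j) v"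
        unfolding a_by_card degree_in_color_class using y3 j True by (simp add: V_def)
      also have "\<dots> = s" using fac j True le by (simp add: is_factorization_def V_def)
      finally show ?thesis .
    next
      case False
      then have "v \<in> W" using v VW(1) by blast
      have "(\<Sum>S\<in>small_subsets V h. \<Sum>R | R \<subseteq> W \<and> card R = h - card S. of_bool (v \<in> S \<or> v \<in> R) * z j S R) =
          (\<Sum>S\<in>small_subsets V h. \<Sum>R | R \<subseteq> W \<and> card R = h - card S. of_bool (v \<in> R) * z j S R)"
        using False by (intro sum.cong[OF refl]) (auto simp: small_subsets_def)
      with z3 j \<open>v \<in> W\<close> show ?thesis by simp
    qed
    finally show ?thesis .
  qed
  moreover have "is_coloring lam n h q c'"
    unfolding is_coloring_def
  proof (intro funcsetI)
    fix p assume "p \<in> hyp_edges lam n h"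
    then obtain X i where p: "p = (X, i)" "X \<in> ?E" "i \<in> {1..lam}"
      using VW(1) by (auto simp: hyp_edges_def)
    show "c' p \<in> {1..q}"
    proof (cases "X \<subseteq> V")
      case True
      then have "p \<in> hyp_edges lam m h" using p by (simp add: hyp_edges_def V_def)
      with col True show ?thesis using p(1) unfolding c'_def is_coloring_def by auto
    next
      case False
      with bspec[OF G p(2)] p(1,3) show ?thesis by (auto simp: c'_def)
    qed
  qed
  moreover have "c' p = c p" if "p \<in> hyp_edges lam m h" for p
    using that by (auto simp: c'_def hyp_edges_def V_def)
  ultimately show ?thesis unfolding is_factorization_def by blast
qed

section \<open>The numerical conditions\<close>

text \<open>Both sides count the pairs of a vertex and an \<open>h\<close>-subset containing it, where the vertex lies in the
  part of size \<open>m\<close> of a set of size \<open>m + u\<close>.\<close>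

lemma weighted_vandermonde:
  assumes "m > 0" "h > 0"
  shows "(\<Sum>i\<le>h. i * ((m choose i) * (u choose (h - i)))) = m * ((m + u - 1) choose (h - 1))"
proof -
  obtain p k where pk: "m = Suc p" "h = Suc k" using assms gr0_implies_Suc by blast
  have absorb: "Suc i * ((Suc p choose Suc i) * (u choose (k - i))) =
      Suc p * ((p choose i) * (u choose (k - i)))" for i
    unfolding mult.assoc[symmetric] Suc_times_binomial ..
  have "(\<Sum>i\<le>h. i * ((m choose i) * (u choose (h - i)))) =
      (\<Sum>i\<le>k. Suc i * ((Suc p choose Suc i) * (u choose (k - i))))"
    unfolding pk by (subst sum.atMost_Suc_shift) simp
  also have "\<dots> = Suc p * ((p + u) choose k)"
    unfolding absorb vandermonde[symmetric] sum_distrib_left ..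
  finally show ?thesis by (simp add: pk)
qed

lemma Suc_times_binomial_Suc: "Suc k * (n choose Suc k) = (n - k) * (n choose k)"
  using binomial_absorb_comp[of n k] binomial_absorption[of k n] by simp

lemma times_choose_3: "k * (k - 1 choose 3) = 4 * (k choose 4)"
  using times_binomial_minus1_eq[of 4 k] by simp

text \<open>With \<open>N\<close> the number of edges in a color class of the given factorization and \<open>u\<close> the number of new
  vertices, this inequality says that a color gets on average at least two edges of type \<open>2\<close>.
  From \<open>3 u \<ge> m\<close> one has \<open>9 u (u - 1) \<ge> m (m - 3)\<close>, which suffices for \<open>N \<ge> 3\<close>. If \<open>N \<le> 2\<close>, then
  \<open>m\<close> divides \<open>4\<close> or \<open>8\<close>, and the integrality of \<open>u\<close> helps.\<close>

lemma edge_count_bound: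
  fixes m u r N :: nat
  assumes "m \<ge> 4" "m \<le> 3 * u" "r * m = 4 * N" "r > 0"
  shows "(m - 2) * (m - 3) \<le> 3 * N * (u * (u - 1))"
proof (cases "N \<ge> 3")
  case True
  have "(m - 2) * (m - 3) \<le> (3 * u) * (3 * (u - 1))"
    using assms by (intro mult_le_mono) auto
  also have "\<dots> = 3 * 3 * (u * (u - 1))" by simp
  also have "\<dots> \<le> 3 * N * (u * (u - 1))" using True by (intro mult_le_mono) auto
  finally show ?thesis .
next
  case False
  have "m \<le> r * m" using assms(4) by simp
  then have m8: "m \<le> 4 * N" using assms(3) by simp
  have "N = 1 \<or> N = 2" using False m8 assms(1) by linarith
  then show ?thesis
  proof
    assume N: "N = 1"
    then have "m = 4" using m8 assms(1) by simp
    then have "2 * 1 \<le> u * (u - 1)" using assms(2) by (intro mult_le_mono) auto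
    then show ?thesis using \<open>m = 4\<close> N assms(2) by simp
  next
    assume N: "N = 2"
    then have "8 = r * m" using assms(3) by simp
    then have "m dvd 8" by (metis dvd_triv_right)
    moreover have "\<not> 5 dvd (8::nat)" "\<not> 6 dvd (8::nat)" "\<not> 7 dvd (8::nat)" by simp_all
    moreover have "m = 4 \<or> m = 5 \<or> m = 6 \<or> m = 7 \<or> m = 8" using m8 N assms(1) by linarith
    ultimately have "m = 4 \<or> m = 8" by metis
    then show ?thesis
    proof
      assume "m = 4"
      then have "2 * 1 \<le> u * (u - 1)" using assms(2) by (intro mult_le_mono) auto
      then show ?thesis using \<open>m = 4\<close> N assms(2) by simp
    next
      assume "m = 8"
      then have "3 * 2 \<le> u * (u - 1)" using assms(2) by (intro mult_le_mono) auto
      then show ?thesis using \<open>m = 8\<close> N by simp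
    qed
  qed
qed

section \<open>Extensions to a complete 4-uniform hypergraph\<close>

text \<open>The two sums required by \<open>equitable_type_distribution\<close> are the Vandermonde identity and its weighted
  form for subsets of size \<open>4\<close>, with the contribution of the edges inside \<open>{1..m}\<close> removed; \<open>N\<close> and \<open>L\<close> are
  the numbers of edges in a color class before and after the extension.\<close>

lemma four_uniform_extension_exists:
  fixes c :: "nat set \<times> nat \<Rightarrow> nat"
  assumes fac: "is_factorization r lam m 4 q c"
    and pos: "r > 0" "lam > 0" and m: "m \<ge> 4" and n: "4 * m \<le> 3 * n"
    and ratio: "r * ((n - 1) choose 3) = s * ((m - 1) choose 3)"
    and dvd: "4 dvd s * n"
  shows "\<exists>c'. is_factorization s lam n 4 q c' \<and> (\<forall>p\<in>hyp_edges lam m 4. c' p = c p)"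
proof -
  define u where "u = n - m"
  have u: "n = m + u" "m \<le> 3 * u" using n m by (auto simp: u_def)
  have m3: "(m - 1) choose 3 > 0" and m4: "m choose 4 > 0" using m by (auto simp: zero_less_binomial_iff)
  have qrm: "q * (r * m) = 4 * (lam * (m choose 4))" by (rule factorization_colors[OF fac])
  have qpos: "q > 0"
  proof (rule ccontr)
    assume "\<not> q > 0"
    with qrm pos m4 show False by simp
  qed
  have "4 * (\<Sum>S | S \<subseteq> {1..m} \<and> card S = 4. copies lam c 1 S) = r * m"
    using qpos by (intro factorization_double_count[OF fac]) simp
  then obtain N where N: "r * m = 4 * N" by metis
  have qN: "q * N = lam * (m choose 4)" using qrm N by simp
  have Npos: "N > 0" using N pos m by (metis gr0I mult_is_0 not_numeral_le_zero)
  have "m * (q * r) = m * (lam * (m - 1 choose 3))"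
    using qrm times_choose_3[of m] by (simp add: algebra_simps)
  then have qr: "q * r = lam * (m - 1 choose 3)" using m by simp
  have "r * (q * s) = r * (lam * (n - 1 choose 3))"
  proof -
    have "r * (q * s) = lam * (s * (m - 1 choose 3))"
      using qr by (metis mult.assoc mult.commute)
    then show ?thesis using ratio by (metis mult.left_commute)
  qed
  then have qs: "q * s = lam * (n - 1 choose 3)" using pos by simp
  have "r * (m - 1 choose 3) \<le> s * (m - 1 choose 3)"
    unfolding ratio[symmetric] using u by (intro mult_le_mono binomial_right_mono) auto
  then have rs: "r \<le> s" using m3 by simp
  obtain L where L: "s * n = 4 * L" using dvd by (elim dvdE)
  have "4 * N \<le> 4 * L" unfolding N[symmetric] L[symmetric] using rs u by (intro mult_le_mono) auto
  then have NL: "N \<le> L" by simp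
  define t where "t i = lam * (m choose i) * (u choose (4 - i))" for i
  define A where "A = m * (s - r)"
  have split4: "(\<Sum>i\<le>4. f i) = (\<Sum>i<4. f i) + f 4" for f :: "nat \<Rightarrow> nat"
    by (simp add: numeral_eq_Suc lessThan_Suc_atMost[symmetric])
  have "4 * (\<Sum>i\<le>4. t i) = 4 * (lam * (n choose 4))"
    unfolding t_def u(1) vandermonde[symmetric] sum_distrib_left by (simp add: mult.assoc)
  also have "\<dots> = lam * (n * (n - 1 choose 3))" unfolding times_choose_3 by simp
  also have "\<dots> = q * (s * n)" using qs by simp
  also have "\<dots> = 4 * (q * L)" unfolding L by simp
  finally have "(\<Sum>i<4. t i) + q * N = q * L"
    unfolding split4 qN by (simp add: t_def)
  then have size: "(\<Sum>i<4. t i) = q * (L - N)" by (simp add: diff_mult_distrib2)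
  have "(\<Sum>i\<le>4. i * t i) = lam * (\<Sum>i\<le>4. i * ((m choose i) * (u choose (4 - i))))"
    unfolding t_def sum_distrib_left by (simp add: mult_ac)
  also have "\<dots> = lam * (m * (n - 1 choose 3))"
    using weighted_vandermonde[of m 4 u] m u by simp
  also have "\<dots> = m * (q * s)" using qs by simp
  finally have "(\<Sum>i<4. i * t i) + m * (q * r) = m * (q * s)"
    unfolding split4 using qrm by (simp add: t_def mult_ac)
  then have deg: "(\<Sum>i<4. i * t i) = q * A"
    unfolding A_def by (simp add: diff_mult_distrib2 mult_ac)
  have b4: "4 * (m choose 4) = (m - 3) * (m choose 3)" and b3: "3 * (m choose 3) = (m - 2) * (m choose 2)"
    and b2: "2 * (u choose 2) = u * (u - 1)"
    using Suc_times_binomial_Suc[of 3 m] Suc_times_binomial_Suc[of 2 m] Suc_times_binomial_Suc[of 1 u]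
    by (simp_all add: numeral_eq_Suc mult_ac)
  \<comment> \<open>both bounds are compared after multiplication by \<open>m choose 4\<close>, which turns \<open>\<lambda> C(m,4)\<close> into \<open>q N\<close>\<close>
  have t3: "q \<le> t 3"
  proof -
    have "4 * (m choose 4) \<le> (4 * u) * (m choose 3)" unfolding b4 using u(2) by (intro mult_le_mono) auto
    then have "m choose 4 \<le> (m choose 3) * u" by (simp add: mult_ac)
    then have "(m choose 4) * q \<le> (m choose 3) * u * (q * N)" using Npos by (intro mult_le_mono) auto
    then have "(m choose 4) * q \<le> (m choose 4) * t 3" unfolding qN by (simp add: t_def mult_ac)
    with m4 show ?thesis by simp
  qed
  have t2: "2 * q \<le> t 2"
  proof -
    have "12 * (m choose 4) = (m choose 2) * ((m - 2) * (m - 3))"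
    proof -
      have "12 * (m choose 4) = (m - 3) * (3 * (m choose 3))" using b4 by simp
      then show ?thesis unfolding b3 by simp
    qed
    also have "\<dots> \<le> (m choose 2) * (3 * N * (u * (u - 1)))"
      by (intro mult_le_mono order_refl edge_count_bound[OF m u(2) N pos(1)])
    also have "\<dots> = 6 * ((m choose 2) * (u choose 2) * N)" unfolding b2[symmetric] by simp
    finally have "2 * (m choose 4) \<le> (m choose 2) * (u choose 2) * N" by (simp add: mult_ac)
    then have "2 * (m choose 4) * q \<le> (m choose 2) * (u choose 2) * N * q" by (rule mult_le_mono1)
    also have "\<dots> = (m choose 2) * (u choose 2) * (q * N)" by simp
    finally have "(m choose 4) * (2 * q) \<le> (m choose 4) * t 2" unfolding qN by (simp add: t_def mult_ac)
    with m4 show ?thesis by simp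
  qed
  from equitable_type_distribution[OF qpos size deg t2 t3] obtain e where
    e1: "\<forall>i\<in>{..<4}. (\<Sum>j=1..q. e j i) = t i" and
    e2: "\<forall>j\<in>{1..q}. (\<Sum>i<4. e j i) = L - N \<and> (\<Sum>i<4. i * e j i) = A"
    by (elim exE conjE)
  show ?thesis
  proof (rule extension_from_type_counts[OF fac, where e = e])
    show "m \<le> n" "r \<le> s" using u rs by simp_all
    show "(\<Sum>j=1..q. e j i) = lam * (m choose i) * ((n - m) choose (4 - i))" if "i < 4" for i
      using e1 that by (simp add: t_def u_def)
    show "(\<Sum>i<4. i * e j i) = m * (s - r)" if "j \<in> {1..q}" for j
      using e2 that by (simp add: A_def)
    show "(\<Sum>i<4. (4 - i) * e j i) = (n - m) * s" if j: "j \<in> {1..q}" for j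
    proof -
      have "(\<Sum>i<4. (4 - i) * e j i) + (\<Sum>i<4. i * e j i) = (\<Sum>i<4. 4 * e j i)"
        unfolding sum.distrib[symmetric] by (intro sum.cong refl) (simp flip: add_mult_distrib)
      then have eq: "(\<Sum>i<4. (4 - i) * e j i) + A = 4 * (L - N)"
        using e2 j by (simp flip: sum_distrib_left)
      have "4 * (L - N) = s * n - r * m" using L N by simp
      also have "\<dots> = (n - m) * s + A"
      proof -
        have "s * m = r * m + A" using rs unfolding A_def
          by (metis add_mult_distrib le_add_diff_inverse mult.commute)
        then show ?thesis unfolding u(1) by (simp add: algebra_simps)
      qed
      finally show ?thesis using eq by simp
    qed
  qed
qed

theorem theorem1p2:
  fixes m n r s lam q :: nat
    and c :: "nat set \<times> nat \<Rightarrow> nat"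
  assumes "m > 0" "n > 0" "r > 0" "s > 0" "lam > 0"
    and "n > m" and "m \<ge> 4"
    and "m = 4 \<longrightarrow> lam \<ge> 2 \<and> r \<ge> 2"
    and "real n \<ge> 4 * real m / 3"
    and "r * ((n - 1) choose 3) = s * ((m - 1) choose 3)"
    and "is_factorization r lam m 4 q c"
  shows "can_be_extended lam m q c s n 4 \<longleftrightarrow>
    4 dvd r * m \<and> 4 dvd s * n \<and>
    r dvd lam * ((m - 1) choose 3) \<and> s dvd lam * ((n - 1) choose 3) \<and>
    1 \<le> real s / real r \<and>
    real s / real r \<le> real ((n - 1) choose 3) / real ((m - 1) choose 3)"
proof
  assume "4 dvd r * m \<and> 4 dvd s * n \<and>
    r dvd lam * ((m - 1) choose 3) \<and> s dvd lam * ((n - 1) choose 3) \<and>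
    1 \<le> real s / real r \<and>
    real s / real r \<le> real ((n - 1) choose 3) / real ((m - 1) choose 3)"
  then have "4 dvd s * n" by blast
  moreover have "4 * m \<le> 3 * n" using assms(9) by linarith
  ultimately obtain c' where "is_factorization s lam n 4 q c'" "\<forall>p\<in>hyp_edges lam m 4. c' p = c p"
    using four_uniform_extension_exists[OF assms(11,3,5,7) _ assms(10)] by blast
  then show "can_be_extended lam m q c s n 4"
    unfolding can_be_extended_def by blast
next
  assume "can_be_extended lam m q c s n 4"
  then obtain q' c' where fac': "is_factorization s lam n 4 q' c'" and qq': "{1..q} \<subseteq> {1..q'}"
    unfolding can_be_extended_def by blast
  have m3: "(m - 1) choose 3 > 0" and m4: "m choose 4 > 0"
    using assms(7) by (auto simp: zero_less_binomial_iff)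
  have quotient: "d dvd lam * (k - 1 choose 3)" if "is_factorization d lam k 4 p b" "k > 0" for d k p b
  proof -
    have "k * (p * d) = k * (lam * (k - 1 choose 3))"
      using factorization_colors[OF that(1)] times_choose_3[of k] by (simp add: algebra_simps)
    then have "lam * (k - 1 choose 3) = p * d" using that(2) by simp
    then show ?thesis by simp
  qed
  have q: "1 \<in> {1..q}"
  proof (rule ccontr)
    assume "1 \<notin> {1..q}"
    then have "q = 0" by auto
    with factorization_colors[OF assms(11)] assms(5) m4 show False by simp
  qed
  then have q': "1 \<in> {1..q'}" using qq' by blast
  have "4 dvd r * m" unfolding factorization_double_count[OF assms(11) q, symmetric] by simp
  moreover have "4 dvd s * n" unfolding factorization_double_count[OF fac' q', symmetric] by simp
  moreover have "r dvd lam * (m - 1 choose 3)" by (rule quotient[OF assms(11,1)])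
  moreover have "s dvd lam * (n - 1 choose 3)" by (rule quotient[OF fac' assms(2)])
  moreover have "r \<le> s"
  proof -
    have "r * (m - 1 choose 3) \<le> s * (m - 1 choose 3)"
      unfolding assms(10)[symmetric] using assms(6) by (intro mult_le_mono binomial_right_mono) auto
    then show ?thesis using m3 by simp
  qed
  then have "1 \<le> real s / real r" using assms(3) by simp
  moreover have "real s / real r \<le> real ((n - 1) choose 3) / real ((m - 1) choose 3)"
  proof -
    have "real r * real ((n - 1) choose 3) = real s * real ((m - 1) choose 3)"
      using assms(10) by (simp flip: of_nat_mult)
    then show ?thesis using assms(3) m3 by (simp add: field_simps)
  qed
  ultimately show "4 dvd r * m \<and> 4 dvd s * n \<and>
    r dvd lam * ((m - 1) choose 3) \<and> s dvd lam * ((n - 1) choose 3) \<and>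
    1 \<le> real s / real r \<and>
    real s / real r \<le> real ((n - 1) choose 3) / real ((m - 1) choose 3)" by blast
qed

end
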